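(* Let $n,k$ be positive integers with $k\geq 2$, and let $\vec{s}=(s_1,\ldots,s_k)$ be an integer vector with $s_i\geq 2$ for $i\neq k$, $s_k\in\{1,2\}$, and $n\geq \sum_{i=1}^{k-1}s_i+2$. Then the neighborhood complex $\mathcal{N}\left(KG(n,k)_{\vec{s}\text{-stab}}\right)$ is homotopy equivalent to the sphere $\mathbb{S}^{\,n-\sum_{i=1}^{k-1}s_i-2}$.
   Context: $[n]=\{1,\ldots,n\}$. For a $k$-subset $A\subseteq[n]$ let $A(1)<A(2)<\cdots<A(k)$ be its elements in increasing order. Given an integer vector $\vec{s}=(s_1,\ldots,s_k)$, a $k$-subset $A\subseteq[n]$ is called $\vec{s}$-stable if $s_j\leq A(j+1)-A(j)$ for all $1\leq j\leq k-1$ and $A(k)-A(1)\leq n-s_k$. The $\vec{s}$-stable Kneser graph $KG(n,k)_{\vec{s}\text{-stab}}$ is the graph whose vertices are the $\vec{s}$-stable $k$-subsets of $[n]$, two vertices being adjacent iff the corresponding sets are disjoint. The neighborhood complex $\mathcal{N}(G)$ of a graph $G$ is the simplicial complex on $V(G)$ whose simplices are the subsets of $V(G)$ having a common neighbor in $G$. *)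

theory Defs
  imports "HOL-Analysis.Analysis"
begin

definition kth_element :: "nat set \<Rightarrow> nat \<Rightarrow> nat" where
  \<comment> \<open>1-based, so that \<open>kth_element A 1 < \<dots> < kth_element A (card A)\<close> lists a finite \<open>A\<close>\<close>
  "kth_element A j = sorted_list_of_set A ! (j - 1)"

text \<open>
  An integer vector \<open>(s\<^sub>1, \<dots>, s\<^sub>k)\<close> is a function on \<open>nat\<close> of which only the values at
  \<open>1, \<dots>, k\<close> are used.
\<close>

definition stable :: "nat \<Rightarrow> nat \<Rightarrow> (nat \<Rightarrow> int) \<Rightarrow> nat set \<Rightarrow> bool" where
  "stable n k s A \<longleftrightarrow>
     A \<subseteq> {1..n} \<and> card A = k \<and>
     (\<forall>j\<in>{1..k - 1}. s j \<le> int (kth_element A (j + 1)) - int (kth_element A j)) \<and>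
     int (kth_element A k) - int (kth_element A 1) \<le> int n - s k"

text \<open>A graph is a vertex set together with its (symmetric, irreflexive) adjacency relation.\<close>

type_synonym 'a graph = "'a set \<times> ('a \<times> 'a) set"

definition stable_kneser_graph :: "nat \<Rightarrow> nat \<Rightarrow> (nat \<Rightarrow> int) \<Rightarrow> nat set graph" where
  "stable_kneser_graph n k s =
     ({A. stable n k s A}, {(A, B). stable n k s A \<and> stable n k s B \<and> A \<inter> B = {}})"

definition neighborhood_complex :: "'a graph \<Rightarrow> 'a set set" where
  "neighborhood_complex G = {S. S \<subseteq> fst G \<and> (\<exists>w\<in>fst G. \<forall>v\<in>S. (v, w) \<in> snd G)}"

text \<open>
  The geometric realization of a finite abstract simplicial complex \<open>K\<close> (a finite, downward closed
  family of finite sets), in barycentric coordinates: the points are the convex weightings of the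
  vertices whose support is a simplex. For finite \<open>K\<close> the topology of pointwise convergence
  is the usual one; for infinite \<open>K\<close> the weak topology may be finer. An empty member of
  \<open>K\<close> contributes no point.
\<close>

definition geometric_realization :: "'a set set \<Rightarrow> ('a \<Rightarrow> real) topology" where
  "geometric_realization K =
     subtopology (powertop_real UNIV)
       {x. (\<forall>v. 0 \<le> x v) \<and> {v. x v \<noteq> 0} \<in> K \<and> (\<Sum>v | x v \<noteq> 0. x v) = 1}"

end

theory Submission
  imports Defs
begin

text \<open>
  Let \<open>W\<close> be the space of all \<open>z \<in> \<real>\<^sup>\<nat>\<close> whose positive coordinates contain a stable set and whose
  negative coordinates contain a stable set. Weighting a stable set \<open>A\<close> by \<open>\<Prod>i\<in>A. max 0 (z i)\<close> maps \<open>W\<close> to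
  the neighborhood complex, and straight line homotopies show that this is a homotopy equivalence.

  Splitting \<open>W\<close> along the hyperplane \<open>z x = 0\<close> removes \<open>x\<close> from the positive (or negative) sets of one
  half and discards the sets through \<open>x\<close> on the other side. Scanning the positions from left to
  right, the first cut (at \<open>x = 1\<close>) gives two halves in which one of the two stable sets is ahead of the
  other; such a space is contractible, because the lead is never lost when all gaps are at
  least 2. The intersection of the halves is a space of the same kind with one unit less of slack.
  So \<open>W\<close> is, up to homotopy, an iterated suspension of the empty space, with as many suspensions as
  there are units of slack.
\<close>

subsection \<open>Gluing two contractible pieces\<close>

text \<open>The spread condition with \<open>s k\<close> is cyclic, while chains are linear. Since
  \<open>s k \<le> 2\<close>, it can only exclude sets through 1: a set with least element at least
  2 has spread at most \<open>n - 2\<close>. After the cut at 1, the sets that avoid 1 are therefore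
  exactly the chains in \<open>{2..n}\<close> with the given gaps. For the sets through 1 a lower
  bound is enough: those whose last element is at most \<open>n - 1\<close> are stable for either
  value of \<open>s k\<close>. The contractibility argument is built to tolerate this: the leading
  side may contain further sets, and its chains may end one position earlier.

  The dimension is a count of slack. The leftmost chain starts at 1 and ends at \<open>p k\<close>,
  one more than the sum of the gaps, so \<open>R = n - p k\<close> units are left. An
  \<open>R\<close>-fold suspension of the empty space is a sphere of dimension \<open>R - 1\<close>.

  Two contractible closed halves determine the homotopy type of their union from that of the
  intersection only if the intersection is well placed. The sign spaces are not compact, so the
  collar must have variable width; this is why it is carried as explicit data.\<close>

lemma homotopic_canonI:
  assumes "continuous_on ({0..1::real} \<times> S) h" "\<And>t x. t \<in> {0..1} \<Longrightarrow> x \<in> S \<Longrightarrow> h (t, x) \<in> T"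
    and "\<And>x. x \<in> S \<Longrightarrow> h (0, x) = f x" "\<And>x. x \<in> S \<Longrightarrow> h (1, x) = g x"
  shows "homotopic_with_canon (\<lambda>_. True) S T f g"
proof -
  have "continuous_map (prod_topology (top_of_set {0..1::real}) (top_of_set S)) (top_of_set T) h"
    using assms(1,2) by (simp flip: subtopology_Times add: image_subset_iff_funcset[symmetric]) auto
  then show ?thesis
    by (subst homotopic_with) (use assms(3,4) in auto)
qed

lemma homotopic_canonE:
  assumes "homotopic_with_canon (\<lambda>_. True) S T f g"
  obtains h where "continuous_on ({0..1::real} \<times> S) h" "\<And>t x. t \<in> {0..1} \<Longrightarrow> x \<in> S \<Longrightarrow> h (t, x) \<in> T"
    and "\<And>x. h (0, x) = f x" "\<And>x. h (1, x) = g x"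
proof -
  obtain h where h: "continuous_map (prod_topology (top_of_set {0..1::real}) (top_of_set S)) (top_of_set T) h"
     "\<forall>x. h (0, x) = f x" "\<forall>x. h (1, x) = g x"
    using assms unfolding homotopic_with_def by blast
  have "continuous_on ({0..1} \<times> S) h" "h \<in> {0..1} \<times> S \<rightarrow> T"
    using h(1) by (auto simp flip: subtopology_Times)
  then show thesis
    using h(2,3) by (intro that[of h]) auto
qed

lemma homotopy_eqvI:
  assumes "continuous_on S f" "f ` S \<subseteq> T" "continuous_on T g" "g ` T \<subseteq> S"
    and "homotopic_with_canon (\<lambda>_. True) S S (\<lambda>x. g (f x)) (\<lambda>x. x)"
    and "homotopic_with_canon (\<lambda>_. True) T T (\<lambda>y. f (g y)) (\<lambda>y. y)"
  shows "S homotopy_eqv T"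
  unfolding homotopy_equivalent_space_def
  using assms by (intro exI[of _ f] exI[of _ g]) (auto simp: o_def id_def)

text \<open>
  The neighbourhood \<open>D\<close> of \<open>A \<inter> B\<close> is pushed by \<open>M\<close> onto \<open>A \<inter> B\<close>, inside \<open>A\<close> and inside \<open>B\<close>. The function \<open>u\<close>
  reaches 1 before \<open>D\<close> is left, so that maps can be extended from \<open>D\<close> by coning them off, without
  any compactness.
\<close>

definition collared :: "'a::topological_space set \<Rightarrow> 'a set \<Rightarrow> 'a set \<Rightarrow> bool" where
  "collared X A B \<longleftrightarrow> closedin (top_of_set X) A \<and> closedin (top_of_set X) B \<and> X = A \<union> B \<and>
     (\<exists>(u :: 'a \<Rightarrow> real) D M. continuous_on X u \<and> u ` X \<subseteq> {0..1} \<and> (\<forall>x\<in>A \<inter> B. u x = 0) \<and>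
        closedin (top_of_set X) D \<and> (\<forall>x\<in>X - D. u x = 1) \<and>
        continuous_on ({0..1::real} \<times> D) M \<and>
        (\<forall>t\<in>{0..1}. \<forall>x\<in>A \<inter> D. M (t, x) \<in> A) \<and> (\<forall>t\<in>{0..1}. \<forall>x\<in>B \<inter> D. M (t, x) \<in> B) \<and>
        (\<forall>x\<in>D. M (0, x) = x \<and> M (1, x) \<in> A \<inter> B) \<and> (\<forall>x\<in>A \<inter> B. M (1, x) = x))"

lemma collaredI:
  fixes u :: "'a::topological_space \<Rightarrow> real"
  assumes "closedin (top_of_set X) A" "closedin (top_of_set X) B" "X = A \<union> B"
    and "continuous_on X u" "u ` X \<subseteq> {0..1}" "\<And>x. x \<in> A \<inter> B \<Longrightarrow> u x = 0"
    and "closedin (top_of_set X) D" "\<And>x. x \<in> X - D \<Longrightarrow> u x = 1"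
    and "continuous_on ({0..1::real} \<times> D) M"
    and "\<And>t x. 0 \<le> t \<Longrightarrow> t \<le> 1 \<Longrightarrow> x \<in> A \<inter> D \<Longrightarrow> M (t, x) \<in> A"
    and "\<And>t x. 0 \<le> t \<Longrightarrow> t \<le> 1 \<Longrightarrow> x \<in> B \<inter> D \<Longrightarrow> M (t, x) \<in> B"
    and "\<And>x. x \<in> D \<Longrightarrow> M (0, x) = x" "\<And>x. x \<in> D \<Longrightarrow> M (1, x) \<in> A \<inter> B"
    and "\<And>x. x \<in> A \<inter> B \<Longrightarrow> M (1, x) = x"
  shows "collared X A B"
  unfolding collared_def
  by (intro conjI assms(1,2,3), rule exI[of _ u], rule exI[of _ D], rule exI[of _ M])
    (use assms(4-14) in simp)

text \<open>The end conditions range over all points, as the homotopies in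
  \<open>homotopic_with\<close> provide. So \<open>H\<close> has a known value at time 1 even for an
  argument outside \<open>S\<close>.\<close>

definition contraction :: "'a::topological_space set \<Rightarrow> (real \<times> 'a \<Rightarrow> 'a) \<Rightarrow> 'a \<Rightarrow> bool" where
  "contraction S H a \<longleftrightarrow> a \<in> S \<and> continuous_on ({0..1} \<times> S) H \<and> H \<in> {0..1} \<times> S \<rightarrow> S \<and>
     (\<forall>x. H (0, x) = x) \<and> (\<forall>x. H (1, x) = a)"

lemma contractible_contraction:
  assumes "contractible S" "S \<noteq> {}"
  obtains H a where "contraction S H a"
proof -
  obtain a where "homotopic_with_canon (\<lambda>_. True) S S id (\<lambda>_. a)"
    using assms(1) unfolding contractible_def by blast
  then obtain H where H: "continuous_on ({0..1::real} \<times> S) H"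
      "\<And>t x. t \<in> {0..1} \<Longrightarrow> x \<in> S \<Longrightarrow> H (t, x) \<in> S" "\<And>x. H (0, x) = id x" "\<And>x. H (1, x) = a"
    by (rule homotopic_canonE) (rule that)
  moreover have "a \<in> S"
    using assms(2) H(2)[of 1] H(4) by auto
  ultimately show thesis
    by (intro that[of H a]) (auto simp: contraction_def)
qed

text \<open>
  The value of \<open>q\<close> outside \<open>D\<close> is irrelevant, since both contractions are constant at time 1.
\<close>

definition cone_map :: "(real \<times> 'b \<Rightarrow> 'b) \<Rightarrow> (real \<times> 'b \<Rightarrow> 'b) \<Rightarrow> 'a set \<Rightarrow> 'a set \<Rightarrow> ('a \<Rightarrow> real) \<Rightarrow>
    ('a \<Rightarrow> 'b) \<Rightarrow> 'a \<Rightarrow> 'b" where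
  "cone_map HA HB ZA D w q z =
     (let y = if z \<in> D then q z else undefined; t = if z \<in> D then w z else 1
      in if z \<in> ZA then HA (t, y) else HB (t, y))"

text \<open>The set where \<open>w\<close> is 1 is closed and covers what \<open>E\<close> misses.
  On it the contraction has already reached its end point \<open>a\<close>, so the two formulas
  paste along closed sets.\<close>

lemma cone_map_half:
  assumes H: "contraction S H a"
    and Z: "closedin (top_of_set Z) E"
    and w: "continuous_on Z w" "w ` Z \<subseteq> {0..1}" "\<forall>z\<in>Z - E. w z = 1"
    and q: "continuous_on E q" "q ` E \<subseteq> S"
  shows "continuous_on Z (\<lambda>z. if z \<in> E then H (w z, q z) else H (1, undefined))"
proof -
  have sub: "E \<subseteq> Z"
    using Z closedin_imp_subset by auto
  define F where "F = {z\<in>Z. w z = 1}"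
  have Zeq: "Z = E \<union> F"
    using sub w(3) by (auto simp: F_def)
  have F: "closedin (top_of_set Z) F"
    unfolding F_def by (rule continuous_closedin_preimage_constant[OF w(1)])
  have "continuous_on (E \<union> F) (\<lambda>z. if z \<in> E then H (w z, q z) else a)"
  proof (rule continuous_on_cases_local)
    show "closedin (top_of_set (E \<union> F)) E" "closedin (top_of_set (E \<union> F)) F"
      using Z F by (simp_all flip: Zeq)
    have "continuous_on ({0..1} \<times> S) H" using H by (simp add: contraction_def)
    moreover have "continuous_on E (\<lambda>z. (w z, q z))"
      using w(1) q(1) sub by (intro continuous_intros) (auto intro: continuous_on_subset)
    moreover have "(\<lambda>z. (w z, q z)) ` E \<subseteq> {0..1} \<times> S"
      using w(2) q(2) sub by blast
    ultimately show "continuous_on E (\<lambda>z. H (w z, q z))"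
      by (rule continuous_on_compose2)
    show "H (w z, q z) = a" if "z \<in> E \<and> z \<notin> E \<or> z \<in> F \<and> z \<in> E" for z
      using that H by (auto simp: F_def contraction_def)
  qed simp
  then show ?thesis
    using H by (simp add: Zeq[symmetric] contraction_def cong: if_cong)
qed

text \<open>Where the halves meet, \<open>w\<close> is 0 and both contractions are still at rest, so
  both formulas give \<open>q\<close> and paste. \<open>Z\<close> is kept abstract because the lemma
  is applied both to a space and to the cylinder over it.\<close>

lemma cone_map:
  assumes HA: "contraction SA HA a" and HB: "contraction SB HB b"
    and Z: "Z = ZA \<union> ZB" "closedin (top_of_set Z) ZA" "closedin (top_of_set Z) ZB" "closedin (top_of_set Z) D"
    and w: "continuous_on Z w" "w ` Z \<subseteq> {0..1}" "\<forall>z\<in>ZA \<inter> ZB. w z = 0" "\<forall>z\<in>Z - D. w z = 1"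
    and q: "continuous_on D q" "\<And>z. z \<in> ZA \<inter> D \<Longrightarrow> q z \<in> SA" "\<And>z. z \<in> ZB \<inter> D \<Longrightarrow> q z \<in> SB"
  shows "continuous_on Z (cone_map HA HB ZA D w q)"
    and "\<And>z. z \<in> ZA \<Longrightarrow> cone_map HA HB ZA D w q z \<in> SA"
    and "\<And>z. z \<in> ZB \<Longrightarrow> cone_map HA HB ZA D w q z \<in> SB"
    and "\<And>z. z \<in> ZA \<inter> ZB \<Longrightarrow> cone_map HA HB ZA D w q z = q z"
proof -
  \<comment> \<open>Outside \<open>D\<close> the value of \<open>w\<close> would be 1, but on the
    intersection it is 0.\<close>
  have inD: "z \<in> D" if "z \<in> ZA \<inter> ZB" for z
    using that w(3,4) Z(1) by force
  have HAB: "HA (0, y) = y" "HB (0, y) = y" for y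
    using HA HB by (simp_all add: contraction_def)
  let ?fA = "\<lambda>z. if z \<in> ZA \<inter> D then HA (w z, q z) else HA (1, undefined)"
  let ?fB = "\<lambda>z. if z \<in> ZB \<inter> D then HB (w z, q z) else HB (1, undefined)"
  have "continuous_on ZA ?fA"
  proof (rule cone_map_half[OF HA])
    show "closedin (top_of_set ZA) (ZA \<inter> D)"
      using Z by (metis closedin_closed_Int closedin_closed closedin_subset_trans closedin_Int inf_le1 sup_ge1)
    show "continuous_on ZA w" using w(1) Z(1) by (auto intro: continuous_on_subset)
    show "continuous_on (ZA \<inter> D) q" using q(1) by (auto intro: continuous_on_subset)
  qed (use w q Z in auto)
  moreover have "continuous_on ZB ?fB"
  proof (rule cone_map_half[OF HB])
    show "closedin (top_of_set ZB) (ZB \<inter> D)"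
      using Z by (metis closedin_closed_Int closedin_closed closedin_subset_trans closedin_Int inf_le1 sup_ge2)
    show "continuous_on ZB w" using w(1) Z(1) by (auto intro: continuous_on_subset)
    show "continuous_on (ZB \<inter> D) q" using q(1) by (auto intro: continuous_on_subset)
  qed (use w q Z in auto)
  ultimately have "continuous_on (ZA \<union> ZB) (\<lambda>z. if z \<in> ZA then ?fA z else ?fB z)"
    using Z w(3) inD by (intro continuous_on_cases_local) (auto simp: HAB)
  moreover have "\<And>z. z \<in> ZA \<union> ZB \<Longrightarrow> (if z \<in> ZA then ?fA z else ?fB z) = cone_map HA HB ZA D w q z"
    using HA HB by (auto simp: cone_map_def contraction_def)
  ultimately show "continuous_on Z (cone_map HA HB ZA D w q)"
    unfolding Z(1) by (rule continuous_on_eq)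
  show eq: "cone_map HA HB ZA D w q z = q z" if "z \<in> ZA \<inter> ZB" for z
    using inD[OF that] that w(3) by (simp add: cone_map_def HAB)
  show A: "cone_map HA HB ZA D w q z \<in> SA" if "z \<in> ZA" for z
  proof (cases "z \<in> D")
    case True
    then have "(w z, q z) \<in> {0..1} \<times> SA" using that w(2) q(2) Z(1) by auto
    then show ?thesis
      using HA that True by (auto simp: cone_map_def contraction_def)
  qed (use HA that in \<open>simp add: cone_map_def contraction_def\<close>)
  show "cone_map HA HB ZA D w q z \<in> SB" if z: "z \<in> ZB" for z
  proof (cases "z \<in> ZA")
    case True
    then show ?thesis using eq[of z] q(3)[of z] inD[of z] z by simp
  next
    case False
    show ?thesis
    proof (cases "z \<in> D")
      case True
      then have "(w z, q z) \<in> {0..1} \<times> SB" using z w(2) q(3) Z(1) by auto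
      then show ?thesis
        using HB z False True by (auto simp: cone_map_def contraction_def)
    qed (use HB False in \<open>simp add: cone_map_def contraction_def\<close>)
  qed
qed

text \<open>The end map \<open>M (1, _)\<close> retracts \<open>D\<close> onto the intersection, so
  \<open>v\<close> extends to \<open>D\<close>. As \<open>u\<close> rises to 1, the contraction of
  the target half carries the value to a fixed point before \<open>D\<close> is left.\<close>

lemma collared_extend:
  assumes X: "collared X A B" and HA: "contraction A' HA a" and HB: "contraction B' HB b"
    and v: "continuous_on (A \<inter> B) v" "v ` (A \<inter> B) \<subseteq> A' \<inter> B'"
  obtains V where "continuous_on X V" "V ` A \<subseteq> A'" "V ` B \<subseteq> B'" "\<And>x. x \<in> A \<inter> B \<Longrightarrow> V x = v x"
proof -
  obtain u D M where c: "closedin (top_of_set X) A" "closedin (top_of_set X) B" "X = A \<union> B"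
    "continuous_on X u" "u ` X \<subseteq> {0..1::real}" "\<forall>x\<in>A \<inter> B. u x = 0"
    "closedin (top_of_set X) D" "\<forall>x\<in>X - D. u x = 1"
    "continuous_on ({0..1::real} \<times> D) M"
    "\<forall>x\<in>D. M (0, x) = x \<and> M (1, x) \<in> A \<inter> B" "\<forall>x\<in>A \<inter> B. M (1, x) = x"
    using X unfolding collared_def by blast
  have "continuous_on D (\<lambda>x. M (1, x))"
    by (rule continuous_on_compose2[OF c(9)]) (auto intro!: continuous_intros)
  then have q: "continuous_on D (\<lambda>x. v (M (1, x)))"
    by (rule continuous_on_compose2[OF v(1)]) (use c(10) in auto)
  have q2: "v (M (1, x)) \<in> A' \<inter> B'" if "x \<in> D" for x
    using that c(10) v(2) by blast
  note cm = cone_map[OF HA HB c(3,1,2,7,4,5,6,8) q]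
  show thesis
  proof (rule that[of "cone_map HA HB A D u (\<lambda>x. v (M (1, x)))"])
    show "cone_map HA HB A D u (\<lambda>x. v (M (1, x))) x = v x" if "x \<in> A \<inter> B" for x
      using cm(4)[of x] q2 c(11) that by simp
  qed (use cm q2 in blast)+
qed

lemma closedin_cylinder:
  "closedin (top_of_set X) A \<Longrightarrow> closedin (top_of_set ({0..1::real} \<times> X)) ({0..1} \<times> A)"
  by (simp add: closedin_Times flip: subtopology_Times)

text \<open>
  Both maps are moved, relative to \<open>A \<inter> B\<close>, to the cone over their restrictions to \<open>A \<inter> B\<close>; the given
  homotopy between the restrictions then extends over the cones.
\<close>

lemma collared_homotopic:
  assumes X: "collared X A B" and HA: "contraction A' HA a" and HB: "contraction B' HB b"
    and g: "continuous_on X g" "g ` A \<subseteq> A'" "g ` B \<subseteq> B'"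
    and g': "continuous_on X g'" "g' ` A \<subseteq> A'" "g' ` B \<subseteq> B'"
    and hom: "homotopic_with_canon (\<lambda>_. True) (A \<inter> B) (A' \<inter> B') g g'"
  shows "homotopic_with_canon (\<lambda>_. True) X (A' \<union> B') g g'"
proof -
  obtain u D M where c: "closedin (top_of_set X) A" "closedin (top_of_set X) B" "X = A \<union> B"
    "continuous_on X u" "u ` X \<subseteq> {0..1::real}" "\<forall>x\<in>A \<inter> B. u x = 0"
    "closedin (top_of_set X) D" "\<forall>x\<in>X - D. u x = 1"
    "continuous_on ({0..1::real} \<times> D) M"
    "\<forall>x\<in>D. M (0, x) = x \<and> M (1, x) \<in> A \<inter> B" "\<forall>x\<in>A \<inter> B. M (1, x) = x"
    and MA: "\<forall>t\<in>{0..1}. \<forall>x\<in>A \<inter> D. M (t, x) \<in> A" and MB: "\<forall>t\<in>{0..1}. \<forall>x\<in>B \<inter> D. M (t, x) \<in> B"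
    using X unfolding collared_def by blast
  obtain h where h: "continuous_on ({0..1::real} \<times> (A \<inter> B)) h"
    "\<And>t x. t \<in> {0..1} \<Longrightarrow> x \<in> A \<inter> B \<Longrightarrow> h (t, x) \<in> A' \<inter> B'"
    "\<And>x. h (0, x) = g x" "\<And>x. h (1, x) = g' x"
    using hom by (rule homotopic_canonE) (rule that)
  let ?Z = "{0..1::real} \<times> X" and ?ZA = "{0..1::real} \<times> A" and ?ZB = "{0..1::real} \<times> B"
  have Z: "?Z = ?ZA \<union> ?ZB" "closedin (top_of_set ?Z) ?ZA" "closedin (top_of_set ?Z) ?ZB"
    using c(1-3) by (auto intro!: closedin_cylinder)
  have DX: "D \<subseteq> X" using c(7) closedin_imp_subset by auto
  have H01: "HA (0, y) = y" "HB (0, y) = y" "HA (1, y) = a" "HB (1, y) = b" for y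
    using HA HB by (simp_all add: contraction_def)
  have usnd: "continuous_on ?Z (\<lambda>z. u (snd z))"
    by (rule continuous_on_compose2[OF c(4)]) (auto intro!: continuous_intros)
  define E1 where "E1 f = cone_map HA HB A X u f" for f
  define E2 where "E2 f = cone_map HA HB A D u (\<lambda>x. f (M (1, x)))" for f
  \<comment> \<open>The contraction is switched on gradually, up to time \<open>u x\<close>; here
    \<open>D\<close> is the whole space.\<close>
  have step1: "homotopic_with_canon (\<lambda>_. True) X (A' \<union> B') f (E1 f)"
    if f: "continuous_on X f" "f ` A \<subseteq> A'" "f ` B \<subseteq> B'" for f
  proof -
    have w: "continuous_on ?Z (\<lambda>z. fst z * u (snd z))" by (intro continuous_intros usnd)
    have w2: "(\<lambda>z. fst z * u (snd z)) ` ?Z \<subseteq> {0..1}"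
    proof clarify
      fix t :: real and x assume "t \<in> {0..1}" "x \<in> X"
      moreover have "u x \<in> {0..1}" using \<open>x \<in> X\<close> c(5) by blast
      ultimately show "fst (t, x) * u (snd (t, x)) \<in> {0..1}" by (simp add: mult_le_one)
    qed
    have q: "continuous_on ?Z (\<lambda>z. f (snd z))"
      by (rule continuous_on_compose2[OF f(1)]) (auto intro!: continuous_intros)
    have w3: "\<forall>z\<in>?ZA \<inter> ?ZB. fst z * u (snd z) = 0" using c(6) by auto
    have w4: "\<forall>z\<in>?Z - ?Z. fst z * u (snd z) = 1" by simp
    have q2: "z \<in> ?ZA \<inter> ?Z \<Longrightarrow> f (snd z) \<in> A'" "z \<in> ?ZB \<inter> ?Z \<Longrightarrow> f (snd z) \<in> B'" for z
      using f by auto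
    note cm = cone_map[OF HA HB Z closedin_self w w2 w3 w4 q q2]
    show ?thesis
    proof (rule homotopic_canonI[OF cm(1)])
      show "cone_map HA HB ?ZA ?Z (\<lambda>z. fst z * u (snd z)) (\<lambda>z. f (snd z)) (t, x) \<in> A' \<union> B'"
        if "t \<in> {0..1}" "x \<in> X" for t x
        using cm(2,3)[of "(t,x)"] that c(3) by blast
    qed (auto simp: E1_def cone_map_def H01 Let_def)
  qed
  have MD: "continuous_on D (\<lambda>x. M (1, x))"
    by (rule continuous_on_compose2[OF c(9)]) (auto intro!: continuous_intros)
  have w2: "(\<lambda>z. u (snd z)) ` ?Z \<subseteq> {0..1}" using c(5) by auto
  have w3: "\<forall>z\<in>?ZA \<inter> ?ZB. u (snd z) = 0" using c(6) by auto
  have w4: "\<forall>z\<in>?Z - {0..1} \<times> D. u (snd z) = 1" using c(8) by auto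
  note cone = cone_map[OF HA HB Z closedin_cylinder[OF c(7)] usnd w2 w3 w4]
  \<comment> \<open>Inside the cone the argument of \<open>f\<close> slides along \<open>M\<close>
    into the intersection. Where \<open>M\<close> is no longer available the cone is already at its
    tip.\<close>
  have step2: "homotopic_with_canon (\<lambda>_. True) X (A' \<union> B') (E1 f) (E2 f)"
    if f: "continuous_on X f" "f ` A \<subseteq> A'" "f ` B \<subseteq> B'" for f
  proof -
    have "M ` ({0..1} \<times> D) \<subseteq> X"
      using MA MB c(3) DX by fastforce
    then have q: "continuous_on ({0..1} \<times> D) (\<lambda>z. f (M z))"
      using continuous_on_compose2[OF f(1) c(9)] by simp
    have q2: "z \<in> ?ZA \<inter> {0..1} \<times> D \<Longrightarrow> f (M z) \<in> A'" "z \<in> ?ZB \<inter> {0..1} \<times> D \<Longrightarrow> f (M z) \<in> B'" for z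
      using MA MB f by blast+
    note cm = cone[OF q q2]
    show ?thesis
    proof (rule homotopic_canonI[OF cm(1)])
      show "cone_map HA HB ?ZA ({0..1} \<times> D) (\<lambda>z. u (snd z)) (\<lambda>z. f (M z)) (t, x) \<in> A' \<union> B'"
        if "t \<in> {0..1}" "x \<in> X" for t x
        using cm(2,3)[of "(t,x)"] that c(3) by blast
      show "cone_map HA HB ?ZA ({0..1} \<times> D) (\<lambda>z. u (snd z)) (\<lambda>z. f (M z)) (0, x) = E1 f x" if "x \<in> X" for x
        using that c(8,10) by (simp add: E1_def cone_map_def H01)
    qed (auto simp: E2_def cone_map_def)
  qed
  \<comment> \<open>\<open>E2 f\<close> sees \<open>f\<close> only on the intersection, where
    \<open>h\<close> connects the two maps.\<close>
  have step3: "homotopic_with_canon (\<lambda>_. True) X (A' \<union> B') (E2 g) (E2 g')"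
  proof -
    have q: "continuous_on ({0..1} \<times> D) (\<lambda>z. h (fst z, M (1, snd z)))"
    proof (rule continuous_on_compose2[OF h(1)])
      show "continuous_on ({0..1} \<times> D) (\<lambda>z. (fst z, M (1, snd z)))"
        by (intro continuous_intros continuous_on_compose2[OF c(9)]) auto
    qed (use c(10) in auto)
    have q2: "z \<in> ?ZA \<inter> {0..1} \<times> D \<Longrightarrow> h (fst z, M (1, snd z)) \<in> A'"
        "z \<in> ?ZB \<inter> {0..1} \<times> D \<Longrightarrow> h (fst z, M (1, snd z)) \<in> B'" for z
      using c(10) h(2)[of "fst z" "M (1, snd z)"] by auto
    note cm = cone[OF q q2]
    show ?thesis
    proof (rule homotopic_canonI[OF cm(1)])
      show "cone_map HA HB ?ZA ({0..1} \<times> D) (\<lambda>z. u (snd z)) (\<lambda>z. h (fst z, M (1, snd z))) (t, x) \<in> A' \<union> B'"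
        if "t \<in> {0..1}" "x \<in> X" for t x
        using cm(2,3)[of "(t,x)"] that c(3) by blast
    qed (auto simp: E2_def cone_map_def h(3,4))
  qed
  note t = homotopic_with_trans and s = homotopic_with_symD
  show ?thesis
    by (rule t[OF step1[OF g] t[OF step2[OF g] t[OF step3 t[OF s[OF step2[OF g']] s[OF step1[OF g']]]]]])
qed

text \<open>Both spaces are, up to homotopy, suspensions of their intersections. The extensions of
  \<open>v\<close> and \<open>w\<close> respect the halves, so their composites are homotopic to the
  identity as soon as this holds on the intersections.\<close>

theorem collared_homotopy_eqv:
  fixes X :: "'a::topological_space set" and Y :: "'b::topological_space set"
  assumes X: "collared X A B" and Y: "collared Y A' B'"
    and A: "contractible A" "A \<noteq> {}" and B: "contractible B" "B \<noteq> {}"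
    and A': "contractible A'" "A' \<noteq> {}" and B': "contractible B'" "B' \<noteq> {}"
    and eq: "(A \<inter> B) homotopy_eqv (A' \<inter> B')"
  shows "X homotopy_eqv Y"
proof -
  obtain HA a HB b where H: "contraction A HA a" "contraction B HB b"
    using contractible_contraction A B by metis
  obtain HA' a' HB' b' where H': "contraction A' HA' a'" "contraction B' HB' b'"
    using contractible_contraction A' B' by metis
  obtain v w where v: "continuous_on (A \<inter> B) v" "v ` (A \<inter> B) \<subseteq> A' \<inter> B'"
    and w: "continuous_on (A' \<inter> B') w" "w ` (A' \<inter> B') \<subseteq> A \<inter> B"
    and wv: "homotopic_with_canon (\<lambda>_. True) (A \<inter> B) (A \<inter> B) (w \<circ> v) id"
    and vw: "homotopic_with_canon (\<lambda>_. True) (A' \<inter> B') (A' \<inter> B') (v \<circ> w) id"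
    using eq unfolding homotopy_equivalent_space_def by (auto simp: image_subset_iff_funcset)
  obtain V where V: "continuous_on X V" "V ` A \<subseteq> A'" "V ` B \<subseteq> B'" "\<And>x. x \<in> A \<inter> B \<Longrightarrow> V x = v x"
    using collared_extend[OF X H' v] by blast
  obtain W where W: "continuous_on Y W" "W ` A' \<subseteq> A" "W ` B' \<subseteq> B" "\<And>x. x \<in> A' \<inter> B' \<Longrightarrow> W x = w x"
    using collared_extend[OF Y H w] by blast
  have XY: "X = A \<union> B" "Y = A' \<union> B'"
    using X Y by (simp_all add: collared_def)
  have VW: "V ` X \<subseteq> Y" "W ` Y \<subseteq> X"
    using V W XY by auto
  have "homotopic_with_canon (\<lambda>_. True) X (A \<union> B) (\<lambda>x. W (V x)) (\<lambda>x. x)"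
  proof (rule collared_homotopic[OF X H])
    show "continuous_on X (\<lambda>x. W (V x))"
      using continuous_on_compose2[OF W(1) V(1) VW(1)] .
    show "homotopic_with_canon (\<lambda>_. True) (A \<inter> B) (A \<inter> B) (\<lambda>x. W (V x)) (\<lambda>x. x)"
      by (rule homotopic_with_eq[OF wv]) (use V(4) W(4) v(2) in \<open>auto simp: image_subset_iff\<close>)
  qed (use V W in \<open>auto simp: image_subset_iff intro!: continuous_intros\<close>)
  moreover have "homotopic_with_canon (\<lambda>_. True) Y (A' \<union> B') (\<lambda>y. V (W y)) (\<lambda>y. y)"
  proof (rule collared_homotopic[OF Y H'])
    show "continuous_on Y (\<lambda>x. V (W x))"
      using continuous_on_compose2[OF V(1) W(1) VW(2)] .
    show "homotopic_with_canon (\<lambda>_. True) (A' \<inter> B') (A' \<inter> B') (\<lambda>x. V (W x)) (\<lambda>x. x)"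
      by (rule homotopic_with_eq[OF vw]) (use V(4) W(4) w(2) in \<open>auto simp: image_subset_iff\<close>)
  qed (use V W in \<open>auto simp: image_subset_iff intro!: continuous_intros\<close>)
  ultimately show ?thesis
    using V W VW XY by (intro homotopy_eqvI[of X V Y W]) auto
qed

text \<open>A contractible model with contractible halves that meet in one point, used for
  comparison in \<open>collared_contractible\<close>.\<close>

lemma collared_UNIV_real: "collared UNIV {0::real..} {..0}"
proof (rule collaredI[where u="\<lambda>x. min 1 \<bar>x\<bar>" and D="{-1..1}" and M="\<lambda>(t, x). (1 - t) * x"])
  show "continuous_on ({0..1} \<times> {-1..1}) (\<lambda>(t, x). (1 - t) * x :: real)"
    by (auto simp: case_prod_beta intro!: continuous_intros)
qed (auto intro!: continuous_intros mult_nonneg_nonpos)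

lemma contractible_homotopy_eqv_sing:
  fixes b :: "'b::topological_space"
  assumes "contractible S" "S \<noteq> {}"
  shows "S homotopy_eqv {b}"
proof -
  obtain H a where H: "contraction S H a"
    using contractible_contraction assms by metis
  then have "homotopic_with_canon (\<lambda>_. True) S S (\<lambda>x. x) (\<lambda>_. a)"
    by (intro homotopic_canonI[of _ H]) (auto simp: contraction_def)
  then have "homotopic_with_canon (\<lambda>_. True) S S (\<lambda>_. a) (\<lambda>x. x)"
    by (rule homotopic_with_symD)
  moreover have "homotopic_with_canon (\<lambda>_. True) {b} {b} (\<lambda>_. b) (\<lambda>x. x)"
    by (rule homotopic_canonI[of _ snd]) (auto intro: continuous_intros)
  ultimately show ?thesis
    using H by (intro homotopy_eqvI[of _ "\<lambda>_. b" _ "\<lambda>_. a"]) (auto simp: contraction_def)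
qed

lemma collared_contractible:
  assumes X: "collared X A B" and "contractible A" "contractible B" "contractible (A \<inter> B)" "A \<inter> B \<noteq> {}"
  shows "contractible X"
proof -
  have "A \<inter> B homotopy_eqv ({0..} \<inter> {..0::real})"
  proof -
    have "{0..} \<inter> {..0::real} = {0}" by auto
    then show ?thesis using assms by (simp add: contractible_homotopy_eqv_sing)
  qed
  then have "X homotopy_eqv (UNIV :: real set)"
    using assms collared_homotopy_eqv[OF X collared_UNIV_real]
    by (metis Int_empty_left Int_empty_right atLeast_eq_UNIV_iff convex_imp_contractible convex_real_interval(1,2) not_empty_eq_Ici_eq_empty atMost_iff empty_iff order_refl)
  then show ?thesis
    by (metis contractible_UNIV contractible_space_top_of_set homotopy_equivalent_space_contractibility)
qed

lemma continuous_on_coordinate [continuous_intros]: "continuous_on S (\<lambda>z. z i)"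
  by (rule continuous_on_subset[OF continuous_on_product_coordinates]) simp

lemma continuous_on_fun_upd [continuous_intros]:
  fixes f :: "'a::topological_space \<Rightarrow> 'i \<Rightarrow> 'b::topological_space"
  assumes "continuous_on S f" "continuous_on S c"
  shows "continuous_on S (\<lambda>s. (f s)(x := c s))"
proof (rule continuous_on_coordinatewise_then_product)
  show "continuous_on S (\<lambda>s. ((f s)(x := c s)) i)" for i
    using assms by (cases "i = x") (auto intro: continuous_on_product_then_coordinatewise)
qed

subsection \<open>Spaces of sign vectors\<close>

text \<open>A thickened form of the box complex. Disjointness of the two sets is automatic, since no
  coordinate is both positive and negative. Two families are needed because a cut treats the two
  signs differently.\<close>

definition sign_space :: "'i set set \<Rightarrow> 'i set set \<Rightarrow> ('i \<Rightarrow> real) set" where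
  "sign_space P Q = {z. (\<exists>A\<in>P. \<forall>i\<in>A. 0 < z i) \<and> (\<exists>B\<in>Q. \<forall>i\<in>B. z i < 0)}"

definition avoiding :: "'i \<Rightarrow> 'i set set \<Rightarrow> 'i set set" where
  "avoiding x P = {A \<in> P. x \<notin> A}"

definition removing :: "'i \<Rightarrow> 'i set set \<Rightarrow> 'i set set" where
  "removing x P = (\<lambda>A. A - {x}) ` P"

text \<open>A sign condition depends only on the inclusion-minimal members of a family, so families
  are compared by this preorder and not by equality.\<close>

definition refines :: "'i set set \<Rightarrow> 'i set set \<Rightarrow> bool" where
  "refines P Q \<longleftrightarrow> (\<forall>A\<in>P. \<exists>B\<in>Q. B \<subseteq> A)"

lemma sign_space_mono: "refines P P' \<Longrightarrow> refines Q Q' \<Longrightarrow> sign_space P Q \<subseteq> sign_space P' Q'"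
  unfolding sign_space_def refines_def by (auto; meson in_mono)

lemma refines_refl: "refines P P"
  by (auto simp: refines_def)

lemma sign_space_swap: "sign_space P Q homotopy_eqv sign_space Q P"
  and sign_space_swap_halfspace:
    "{z \<in> sign_space P Q. z x \<le> 0} homotopy_eqv {z \<in> sign_space Q P. 0 \<le> z x}"
proof -
  have c: "continuous_on S (\<lambda>z i. - z i)" for S :: "('i \<Rightarrow> real) set"
    by (intro continuous_intros)
  have homeo: "S homotopy_eqv T"
    if "\<And>z. z \<in> S \<Longrightarrow> (\<lambda>i. - z i) \<in> T" "\<And>z. z \<in> T \<Longrightarrow> (\<lambda>i. - z i) \<in> S" for S T :: "('i \<Rightarrow> real) set"
    unfolding homotopy_equivalent_space_def using c that
    by (intro exI[of _ "\<lambda>z i. - z i"]) (auto simp: o_def id_def)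
  show "sign_space P Q homotopy_eqv sign_space Q P"
    by (rule homeo) (auto simp: sign_space_def)
  show "{z \<in> sign_space P Q. z x \<le> 0} homotopy_eqv {z \<in> sign_space Q P. 0 \<le> z x}"
    by (rule homeo) (auto simp: sign_space_def)
qed

lemma homotopic_fun_upd:
  fixes S :: "('i \<Rightarrow> real) set"
  assumes "\<And>z t. z \<in> S \<Longrightarrow> 0 \<le> t \<Longrightarrow> t \<le> 1 \<Longrightarrow> z(x := (1 - t) * c + t * z x) \<in> S"
  shows "homotopic_with_canon (\<lambda>_. True) S S (\<lambda>z. z(x := c)) (\<lambda>z. z)"
proof (rule homotopic_canonI)
  show "continuous_on ({0..1} \<times> S) (\<lambda>p. (snd p)(x := (1 - fst p) * c + fst p * snd p x))"
    by (intro continuous_on_fun_upd continuous_intros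
        continuous_on_product_then_coordinatewise[OF continuous_on_snd])
qed (use assms in auto)

lemma homotopy_eqv_fun_upd:
  fixes S T :: "('i \<Rightarrow> real) set"
  assumes "\<And>z. z \<in> S \<Longrightarrow> z(x := c) \<in> T" "\<And>z. z \<in> T \<Longrightarrow> z(x := c) \<in> S"
    and "\<And>z t. z \<in> S \<Longrightarrow> 0 \<le> t \<Longrightarrow> t \<le> 1 \<Longrightarrow> z(x := (1 - t) * c + t * z x) \<in> S"
    and "\<And>z t. z \<in> T \<Longrightarrow> 0 \<le> t \<Longrightarrow> t \<le> 1 \<Longrightarrow> z(x := (1 - t) * c + t * z x) \<in> T"
  shows "S homotopy_eqv T"
proof (rule homotopy_eqvI)
  show "continuous_on S (\<lambda>z. z(x := c))" "continuous_on T (\<lambda>z. z(x := c))"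
    by (intro continuous_on_fun_upd continuous_on_id continuous_on_const)+
qed (use assms in \<open>auto intro!: homotopic_fun_upd\<close>)

lemma sign_spaceI: "A \<in> P \<Longrightarrow> B \<in> Q \<Longrightarrow> (\<And>i. i \<in> A \<Longrightarrow> 0 < z i) \<Longrightarrow> (\<And>i. i \<in> B \<Longrightarrow> z i < 0) \<Longrightarrow> z \<in> sign_space P Q"
  by (auto simp: sign_space_def)

lemma sign_spaceE:
  assumes "z \<in> sign_space P Q"
  obtains A B where "A \<in> P" "B \<in> Q" "\<forall>i\<in>A. 0 < z i" "\<forall>i\<in>B. z i < 0"
  using assms unfolding sign_space_def by blast

lemma sign_space_fun_upd:
  assumes "z \<in> sign_space P Q"
  shows "(\<And>A. A \<in> P \<Longrightarrow> x \<notin> A) \<Longrightarrow> (\<And>B. B \<in> Q \<Longrightarrow> x \<notin> B) \<Longrightarrow> z(x := c) \<in> sign_space P Q"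
    and "(\<And>B. B \<in> Q \<Longrightarrow> x \<notin> B) \<Longrightarrow> z(x := c) \<in> sign_space (removing x P) Q"
    and "(\<And>B. B \<in> Q \<Longrightarrow> x \<notin> B) \<Longrightarrow> (0 < z x \<Longrightarrow> 0 < c) \<Longrightarrow> z(x := c) \<in> sign_space P Q"
proof -
  obtain A B where AB: "A \<in> P" "B \<in> Q" "\<forall>i\<in>A. 0 < z i" "\<forall>i\<in>B. z i < 0"
    using assms by (rule sign_spaceE)
  show "z(x := c) \<in> sign_space P Q" if "\<And>A. A \<in> P \<Longrightarrow> x \<notin> A" "\<And>B. B \<in> Q \<Longrightarrow> x \<notin> B"
    by (rule sign_spaceI[OF AB(1,2)]) (use AB that in auto)
  show "z(x := c) \<in> sign_space (removing x P) Q" if "\<And>B. B \<in> Q \<Longrightarrow> x \<notin> B"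
    by (rule sign_spaceI[of "A - {x}" _ B]) (use AB that in \<open>auto simp: removing_def\<close>)
  show "z(x := c) \<in> sign_space P Q" if "\<And>B. B \<in> Q \<Longrightarrow> x \<notin> B" "0 < z x \<Longrightarrow> 0 < c"
    by (rule sign_spaceI[OF AB(1,2)]) (use AB that in auto)
qed

lemma sign_space_fun_upd_removing:
  assumes "z \<in> sign_space (removing x P) Q" "\<And>B. B \<in> Q \<Longrightarrow> x \<notin> B" "0 < c"
  shows "z(x := c) \<in> sign_space P Q"
proof -
  obtain A B where AB: "A \<in> removing x P" "B \<in> Q" "\<forall>i\<in>A. 0 < z i" "\<forall>i\<in>B. z i < 0"
    using assms(1) by (rule sign_spaceE)
  then obtain A' where "A' \<in> P" "A = A' - {x}" by (auto simp: removing_def)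
  then show ?thesis
    by (intro sign_spaceI[of A' _ B]) (use AB assms in auto)
qed

text \<open>No negative set restricts coordinate \<open>x\<close>, so it can be raised to 1, after
  which \<open>x\<close> is no longer a condition on a positive set.\<close>

lemma sign_space_removing:
  assumes Q: "\<And>B. B \<in> Q \<Longrightarrow> x \<notin> B"
  shows "sign_space P Q homotopy_eqv sign_space (removing x P) Q"
proof (rule homotopy_eqv_fun_upd[where x=x and c=1])
  fix z :: "'a \<Rightarrow> real" and t :: real
  assume t: "0 \<le> t" "t \<le> 1"
  have "0 < (1 - t) * 1 + t * z x" if "0 < z x"
    using t that by (cases "t = 1") (auto intro!: add_pos_nonneg)
  then show "z(x := (1 - t) * 1 + t * z x) \<in> sign_space P Q" if "z \<in> sign_space P Q"
    using that by (intro sign_space_fun_upd(3)) (auto dest: Q)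
  show "z(x := (1 - t) * 1 + t * z x) \<in> sign_space (removing x P) Q" if "z \<in> sign_space (removing x P) Q"
    using that by (intro sign_space_fun_upd(1)) (auto simp: removing_def dest: Q)
qed (use Q in \<open>auto intro!: sign_space_fun_upd(2) sign_space_fun_upd_removing\<close>)

text \<open>In this half no negative set can use \<open>x\<close>, and moving coordinate
  \<open>x\<close> up to 1 never leaves the half. So \<open>x\<close> is lost to the negative side
  and free for the positive one.\<close>

lemma sign_space_nonneg:
  "{z \<in> sign_space P Q. 0 \<le> z x} homotopy_eqv sign_space (removing x P) (avoiding x Q)"
proof -
  have avoid: "z \<in> sign_space P (avoiding x Q)" if z: "z \<in> sign_space P Q" "0 \<le> z x" for P :: "'a set set" and z
  proof -
    obtain A B where "A \<in> P" "B \<in> Q" "\<forall>i\<in>A. 0 < z i" "\<forall>i\<in>B. z i < 0"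
      using z(1) by (rule sign_spaceE)
    then show ?thesis
      using z(2) by (intro sign_spaceI[of A _ B]) (force simp: avoiding_def)+
  qed
  have sub: "sign_space P (avoiding x Q) \<subseteq> sign_space P Q"
    by (auto simp: sign_space_def avoiding_def)
  have Q: "x \<notin> B" if "B \<in> avoiding x Q" for B
    using that by (simp add: avoiding_def)
  show ?thesis
  proof (rule homotopy_eqv_fun_upd[where x=x and c=1])
    show "z(x := 1) \<in> sign_space (removing x P) (avoiding x Q)" if "z \<in> {z \<in> sign_space P Q. 0 \<le> z x}" for z
      using that avoid Q by (intro sign_space_fun_upd(2)) auto
    show "z(x := 1) \<in> {z \<in> sign_space P Q. 0 \<le> z x}" if "z \<in> sign_space (removing x P) (avoiding x Q)" for z
      using sign_space_fun_upd_removing[OF that, of 1] Q sub by auto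
    show "z(x := (1 - t) * 1 + t * z x) \<in> sign_space (removing x P) (avoiding x Q)"
      if "z \<in> sign_space (removing x P) (avoiding x Q)" for z t
      using that Q by (intro sign_space_fun_upd(1)) (auto simp: removing_def)
    fix z :: "'a \<Rightarrow> real" and t :: real
    assume z: "z \<in> {z \<in> sign_space P Q. 0 \<le> z x}" and t: "0 \<le> t" "t \<le> 1"
    have "0 < (1 - t) * 1 + t * z x" if "0 < z x"
      using t that by (cases "t = 1") (auto intro!: add_pos_nonneg)
    then have "z(x := (1 - t) * 1 + t * z x) \<in> sign_space P (avoiding x Q)"
      using z avoid Q by (intro sign_space_fun_upd(3)) auto
    moreover have "0 \<le> (1 - t) * 1 + t * z x"
      using t z by simp
    ultimately show "z(x := (1 - t) * 1 + t * z x) \<in> {z \<in> sign_space P Q. 0 \<le> z x}"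
      using sub by auto
  qed
qed

lemma sign_space_nonpos:
  "{z \<in> sign_space P Q. z x \<le> 0} homotopy_eqv sign_space (avoiding x P) (removing x Q)"
  using homotopy_eqv_trans[OF sign_space_swap_halfspace homotopy_eqv_trans[OF sign_space_nonneg sign_space_swap]] .

lemma sign_space_zero:
  "{z \<in> sign_space P Q. z x = 0} homotopy_eqv sign_space (avoiding x P) (avoiding x Q)"
proof -
  have *: "z \<in> sign_space (avoiding x P) (avoiding x Q)" if z: "z \<in> sign_space P Q" "z x = 0" for z
  proof -
    obtain A B where "A \<in> P" "B \<in> Q" "\<forall>i\<in>A. 0 < z i" "\<forall>i\<in>B. z i < 0"
      using z(1) by (rule sign_spaceE)
    then show ?thesis
      using z(2) by (intro sign_spaceI[of A _ B]) (force simp: avoiding_def)+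
  qed
  have upd: "z(x := c) \<in> sign_space (avoiding x P) (avoiding x Q)"
    if "z \<in> sign_space (avoiding x P) (avoiding x Q)" for z c
    using that by (intro sign_space_fun_upd(1)) (auto simp: avoiding_def)
  have sub: "sign_space (avoiding x P) (avoiding x Q) \<subseteq> sign_space P Q"
    by (auto simp: sign_space_def avoiding_def)
  show ?thesis
  proof (rule homotopy_eqv_fun_upd[where x=x and c=0])
    show "z(x := 0) \<in> {z \<in> sign_space P Q. z x = 0}"
      if "z \<in> sign_space (avoiding x P) (avoiding x Q)" for z
      using upd[OF that, of 0] sub by auto
    show "z(x := (1 - t) * 0 + t * z x) \<in> {z \<in> sign_space P Q. z x = 0}"
      if "z \<in> {z \<in> sign_space P Q. z x = 0}" for z t
      using that by (auto simp: fun_upd_idem)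
  qed (use upd * in auto)
qed

text \<open>A continuous function whose positivity detects a member of \<open>P\<close> inside the
  positive coordinates. It supplies collar widths and the normalisation of barycentric
  weights.\<close>

definition monomial_sum :: "'i set set \<Rightarrow> ('i \<Rightarrow> real) \<Rightarrow> real" where
  "monomial_sum P z = (\<Sum>A\<in>P. \<Prod>i\<in>A. max 0 (z i))"

lemma monomial_sum_nonneg: "0 \<le> monomial_sum P z"
  by (auto simp: monomial_sum_def intro!: sum_nonneg prod_nonneg)

lemma monomial_sum_pos_iff:
  assumes "finite P" "\<And>A. A \<in> P \<Longrightarrow> finite A"
  shows "0 < monomial_sum P z \<longleftrightarrow> (\<exists>A\<in>P. \<forall>i\<in>A. 0 < z i)"
proof
  assume "\<exists>A\<in>P. \<forall>i\<in>A. 0 < z i"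
  then obtain A where A: "A \<in> P" "\<forall>i\<in>A. 0 < z i" by blast
  then have "0 < (\<Prod>i\<in>A. max 0 (z i))" by (auto intro!: prod_pos)
  then show "0 < monomial_sum P z"
    unfolding monomial_sum_def using A(1) assms(1) by (intro sum_pos2[of _ A]) (auto intro!: prod_nonneg)
next
  assume "0 < monomial_sum P z"
  then obtain A where A: "A \<in> P" "(\<Prod>i\<in>A. max 0 (z i)) \<noteq> 0"
    unfolding monomial_sum_def by (metis less_irrefl sum.neutral)
  then have "\<forall>i\<in>A. 0 < z i"
    using assms(2)[OF A(1)] by (auto simp: max_def not_le split: if_splits)
  then show "\<exists>A\<in>P. \<forall>i\<in>A. 0 < z i" using A(1) by blast
qed

lemma continuous_on_monomial_sum [continuous_intros]:
  assumes "continuous_on S f"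
  shows "continuous_on S (\<lambda>s. monomial_sum P (f s))"
  unfolding monomial_sum_def
  by (intro continuous_intros continuous_on_product_then_coordinatewise[OF assms])

text \<open>Setting coordinate \<open>x\<close> to 0 may leave the space, so a constant width does
  not work in general. The width \<open>m\<close> is continuous and positive exactly where both sets
  can be chosen without \<open>x\<close>; hence on \<open>D\<close> the coordinate can be shrunk to
  0.\<close>

lemma collared_sign_space:
  assumes P: "finite P" "\<And>A. A \<in> P \<Longrightarrow> finite A" and Q: "finite Q" "\<And>B. B \<in> Q \<Longrightarrow> finite B"
  shows "collared (sign_space P Q) {z \<in> sign_space P Q. 0 \<le> z x} {z \<in> sign_space P Q. z x \<le> 0}"
proof -
  let ?W = "sign_space P Q"
  define m where "m z = monomial_sum (avoiding x P) z * monomial_sum (avoiding x Q) (\<lambda>i. - z i)" for z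
  define D where "D = {z \<in> ?W. \<bar>z x\<bar> \<le> m z}"
  have m0: "0 \<le> m z" for z
    by (simp add: m_def monomial_sum_nonneg)
  have mpos: "0 < m z \<longleftrightarrow> z \<in> sign_space (avoiding x P) (avoiding x Q)" for z
  proof -
    have "0 < m z \<longleftrightarrow> 0 < monomial_sum (avoiding x P) z \<and> 0 < monomial_sum (avoiding x Q) (\<lambda>i. - z i)"
      using monomial_sum_nonneg by (auto simp: m_def zero_less_mult_iff not_less[symmetric])
    then show ?thesis
      using P Q by (subst (asm) (1 2) monomial_sum_pos_iff) (auto simp: avoiding_def sign_space_def)
  qed
  have mz: "0 < m z" if "z \<in> ?W" "z x = 0" for z
    using that unfolding mpos by (force simp: sign_space_def avoiding_def)
  have cm: "continuous_on S m" for S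
    unfolding m_def by (intro continuous_intros)
  have Deq: "D = ?W \<inter> {z. \<bar>z x\<bar> \<le> m z}" by (auto simp: D_def)
  have Dcl: "closedin (top_of_set ?W) D"
    unfolding Deq by (intro closedin_closed_Int closed_Collect_le continuous_intros cm)
  have Aeq: "{z \<in> ?W. 0 \<le> z x} = ?W \<inter> {z. 0 \<le> z x}" "{z \<in> ?W. z x \<le> 0} = ?W \<inter> {z. z x \<le> 0}" by auto
  have cl: "closedin (top_of_set ?W) {z \<in> ?W. 0 \<le> z x}" "closedin (top_of_set ?W) {z \<in> ?W. z x \<le> 0}"
    unfolding Aeq by (intro closedin_closed_Int closed_Collect_le continuous_intros)+
  \<comment> \<open>The denominator is positive because \<open>m\<close> is positive on the wall
    \<open>z x = 0\<close>; the quotient becomes 1 as soon as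
    \<open>m z \<le> \<bar>z x\<bar>\<close>.\<close>
  define u where "u z = \<bar>z x\<bar> / max \<bar>z x\<bar> (m z)" for z
  have den: "0 < max \<bar>z x\<bar> (m z)" if "z \<in> ?W" for z
    using mz[OF that] by (cases "z x = 0") auto
  have cu: "continuous_on ?W u"
    unfolding u_def by (intro continuous_intros cm) (use den in force)
  have u01: "u ` ?W \<subseteq> {0..1}"
    using den by (force simp: u_def divide_le_eq_1)
  have u1: "\<forall>z\<in>?W - D. u z = 1"
    using m0 by (auto simp: u_def D_def max_def)
  define M where "M = (\<lambda>(t, z). z(x := (1 - t) * z x) :: 'a \<Rightarrow> real)"
  have MW: "M (t, z) \<in> ?W" if "z \<in> D" for t z
  proof -
    have "0 < m z"
      using that mz[of z] by (cases "z x = 0") (auto simp: D_def)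
    then show ?thesis
      unfolding mpos by (force simp: M_def sign_space_def avoiding_def)
  qed
  have Mx: "M (t, z) x = (1 - t) * z x" and M0: "M (0, z) = z" for t z
    by (simp_all add: M_def)
  have cM: "continuous_on ({0..1} \<times> D) M"
    unfolding M_def case_prod_beta
    by (intro continuous_intros continuous_on_product_then_coordinatewise[OF continuous_on_snd])
  show ?thesis
  proof (rule collaredI[where u=u and D=D and M=M])
    show "u z = 0" if "z \<in> {z \<in> ?W. 0 \<le> z x} \<inter> {z \<in> ?W. z x \<le> 0}" for z
      using that by (simp add: u_def)
    show "M (1, z) = z" if "z \<in> {z \<in> ?W. 0 \<le> z x} \<inter> {z \<in> ?W. z x \<le> 0}" for z
      using that by (auto simp: M_def fun_eq_iff)
  qed (use cu u01 Dcl u1 cM cl in \<open>auto simp: Mx MW M0 mult_nonneg_nonpos\<close>)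
qed

subsection \<open>Chains with prescribed gaps\<close>

text \<open>
  A chain has its \<open>l\<close>-th element at the leftmost possible position \<open>p l\<close> plus a slack \<open>f l\<close>. The gap
  conditions say that the slack is weakly increasing.
\<close>

definition slack_chains :: "(nat \<Rightarrow> nat) \<Rightarrow> nat \<Rightarrow> nat \<Rightarrow> nat \<Rightarrow> nat \<Rightarrow> nat set set" where
  "slack_chains p k i a R = {(\<lambda>l. p l + f l) ` {i..k} |f. mono_on {i..k} f \<and> (\<forall>l\<in>{i..k}. a \<le> f l \<and> f l \<le> R)}"

lemma slack_chains_done: "k < i \<Longrightarrow> slack_chains p k i a R = {{}}"
  by (auto simp: slack_chains_def intro: exI[of _ "\<lambda>_. a"])

lemma slack_chains_empty: "i \<le> k \<Longrightarrow> R < a \<Longrightarrow> slack_chains p k i a R = {}"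
  by (force simp: slack_chains_def)

lemma slack_chains_finite: "finite (slack_chains p k i a R)"
  and slack_chains_finite_member: "A \<in> slack_chains p k i a R \<Longrightarrow> finite A"
proof -
  have "slack_chains p k i a R \<subseteq> Pow (\<Union>l\<in>{i..k}. (\<lambda>c. p l + c) ` {..R})"
    by (auto simp: slack_chains_def)
  then show "finite (slack_chains p k i a R)"
    by (rule finite_subset) auto
  show "A \<in> slack_chains p k i a R \<Longrightarrow> finite A"
    by (auto simp: slack_chains_def)
qed

lemma slack_chains_inactive:
  assumes "strict_mono_on {i..k} p" "i \<le> k \<longrightarrow> x < p i + a" "A \<in> slack_chains p k i a R"
  shows "x \<notin> A"
proof
  assume "x \<in> A"
  then obtain f l where l: "l \<in> {i..k}" "a \<le> f l" "x = p l + f l"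
    using assms(3) by (auto simp: slack_chains_def)
  have "p i \<le> p l"
    using strict_mono_onD[OF assms(1), of i l] l by (cases "i = l") auto
  then show False using l assms(2) by auto
qed

text \<open>Position \<open>p i + a\<close> can be occupied only by the first element, with least
  slack. If that is forbidden, monotonicity raises the slack of all later elements too.\<close>

lemma slack_chains_avoiding:
  assumes p: "strict_mono_on {i..k} p" and "i \<le> k"
  shows "avoiding (p i + a) (slack_chains p k i a R) = slack_chains p k i (Suc a) R"
proof -
  have *: "(\<forall>l\<in>{i..k}. p i + a \<noteq> p l + f l) \<longleftrightarrow> (\<forall>l\<in>{i..k}. Suc a \<le> f l)"
    if f: "mono_on {i..k} f" "\<forall>l\<in>{i..k}. a \<le> f l \<and> f l \<le> R" for f
  proof
    assume "\<forall>l\<in>{i..k}. p i + a \<noteq> p l + f l"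
    then have "f i \<noteq> a" using \<open>i \<le> k\<close> by auto
    moreover have "f i \<le> f l" if "l \<in> {i..k}" for l
      using monotone_onD[OF f(1), of i l] that by auto
    ultimately show "\<forall>l\<in>{i..k}. Suc a \<le> f l"
      using f(2) \<open>i \<le> k\<close> by (metis Suc_leI atLeastAtMost_iff le_neq_implies_less le_trans order_refl)
  next
    assume f: "\<forall>l\<in>{i..k}. Suc a \<le> f l"
    have "p i \<le> p l" if "l \<in> {i..k}" for l
      using strict_mono_onD[OF p, of i l] that by (cases "i = l") auto
    with f show "\<forall>l\<in>{i..k}. p i + a \<noteq> p l + f l" by fastforce
  qed
  have "A \<in> avoiding (p i + a) (slack_chains p k i a R) \<longleftrightarrow> A \<in> slack_chains p k i (Suc a) R" for A
  proof -
    have "A \<in> avoiding (p i + a) (slack_chains p k i a R) \<longleftrightarrow>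
      (\<exists>f. A = (\<lambda>l. p l + f l) ` {i..k} \<and> mono_on {i..k} f \<and> (\<forall>l\<in>{i..k}. a \<le> f l \<and> f l \<le> R)
        \<and> (\<forall>l\<in>{i..k}. p i + a \<noteq> p l + f l))"
      by (auto simp: avoiding_def slack_chains_def)
    also have "\<dots> \<longleftrightarrow> (\<exists>f. A = (\<lambda>l. p l + f l) ` {i..k} \<and> mono_on {i..k} f \<and>
        (\<forall>l\<in>{i..k}. a \<le> f l \<and> f l \<le> R) \<and> (\<forall>l\<in>{i..k}. Suc a \<le> f l))"
      by (intro ex_cong1 conj_cong refl *)
    also have "\<dots> \<longleftrightarrow> A \<in> slack_chains p k i (Suc a) R"
      unfolding slack_chains_def mem_Collect_eq by (intro ex_cong1) (auto simp: Suc_le_eq less_imp_le)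
    finally show ?thesis .
  qed
  then show ?thesis by blast
qed

lemma slack_chains_extend:
  assumes Q: "Q \<in> slack_chains p k (Suc i) a R" and "i \<le> k" "a \<le> R"
  shows "insert (p i + a) Q \<in> slack_chains p k i a R"
proof -
  obtain f where f: "Q = (\<lambda>l. p l + f l) ` {Suc i..k}" "mono_on {Suc i..k} f"
    "\<forall>l\<in>{Suc i..k}. a \<le> f l \<and> f l \<le> R"
    using Q by (auto simp: slack_chains_def)
  have "insert (p i + a) Q = (\<lambda>l. p l + (f(i := a)) l) ` {i..k}"
    using \<open>i \<le> k\<close> by (auto simp: f(1) atLeastAtMost_insertL[symmetric] simp del: atLeastAtMost_insertL)
  moreover have "mono_on {i..k} (f(i := a))"
    using f(3) by (auto intro!: monotone_onI monotone_onD[OF f(2)])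
  ultimately show ?thesis
    unfolding slack_chains_def using f(3) \<open>a \<le> R\<close> by (auto intro!: exI[of _ "f(i := a)"])
qed

lemma slack_chains_tail:
  assumes "Q \<in> slack_chains p k i a R"
  obtains Q' where "Q' \<in> slack_chains p k (Suc i) a R" "Q' \<subseteq> Q"
proof -
  obtain f where f: "Q = (\<lambda>l. p l + f l) ` {i..k}" "mono_on {i..k} f" "\<forall>l\<in>{i..k}. a \<le> f l \<and> f l \<le> R"
    using assms by (auto simp: slack_chains_def)
  show thesis
    by (rule that[of "(\<lambda>l. p l + f l) ` {Suc i..k}"])
      (use f in \<open>auto simp: slack_chains_def intro!: exI[of _ f] intro: monotone_on_subset\<close>)
qed

lemma strict_mono_on_tail: "strict_mono_on {i..k::nat} p \<Longrightarrow> i \<le> j \<Longrightarrow> strict_mono_on {j..k} p"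
  by (erule monotone_on_subset) auto

lemma refines_trans: "refines P Q \<Longrightarrow> refines Q R \<Longrightarrow> refines P R"
  unfolding refines_def by (meson order_trans)

text \<open>Equality fails in general: chains that do not start at \<open>p i + a\<close> survive
  the removal in full length. They still contain a chain without the \<open>i\<close>-th
  element.\<close>

lemma slack_chains_removing:
  assumes p: "strict_mono_on {i..k} p" and "i \<le> k" "a \<le> R"
  shows "refines (slack_chains p k (Suc i) a R) (removing (p i + a) (slack_chains p k i a R))"
    and "refines (removing (p i + a) (slack_chains p k i a R)) (slack_chains p k (Suc i) a R)"
proof -
  have inact: "p i + a \<notin> Q" if "Q \<in> slack_chains p k (Suc i) a R" for Q
    by (rule slack_chains_inactive[OF _ _ that])
      (use strict_mono_onD[OF p, of i "Suc i"] in \<open>auto intro: strict_mono_on_tail[OF p]\<close>)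
  show "refines (slack_chains p k (Suc i) a R) (removing (p i + a) (slack_chains p k i a R))"
    unfolding refines_def removing_def
  proof (intro ballI bexI)
    fix Q assume "Q \<in> slack_chains p k (Suc i) a R"
    then show "insert (p i + a) Q - {p i + a} \<in> (\<lambda>A. A - {p i + a}) ` slack_chains p k i a R"
      using slack_chains_extend[OF _ assms(2,3)] by blast
  qed auto
  show "refines (removing (p i + a) (slack_chains p k i a R)) (slack_chains p k (Suc i) a R)"
    unfolding refines_def removing_def
  proof clarify
    fix Q assume "Q \<in> slack_chains p k i a R"
    then obtain Q' where "Q' \<in> slack_chains p k (Suc i) a R" "Q' \<subseteq> Q" by (rule slack_chains_tail)
    then show "\<exists>B\<in>slack_chains p k (Suc i) a R. B \<subseteq> Q - {p i + a}"
      using inact by blast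
  qed
qed

section \<open>Refinement and contractibility criteria for sign spaces\<close>

lemma refines_avoiding: "refines P Q \<Longrightarrow> refines (avoiding x P) (avoiding x Q)"
  unfolding refines_def avoiding_def by blast

lemma refines_removing:
  assumes "refines P Q"
  shows "refines (removing x P) (removing x Q)"
  unfolding refines_def removing_def
proof clarify
  fix A assume "A \<in> P"
  then obtain B where "B \<in> Q" "B \<subseteq> A" using assms by (auto simp: refines_def)
  then show "\<exists>B\<in>(\<lambda>A. A - {x}) ` Q. B \<subseteq> A - {x}"
    by (intro bexI[of _ "B - {x}"]) auto
qed

lemma removing_refines: "refines P (removing x P)"
  by (auto simp: refines_def removing_def)

lemma sign_space_eq:
  "refines P P' \<Longrightarrow> refines P' P \<Longrightarrow> refines Q Q' \<Longrightarrow> refines Q' Q \<Longrightarrow> sign_space P Q = sign_space P' Q'"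
  by (intro equalityI sign_space_mono)

lemma homotopy_eqv_contractible: "S homotopy_eqv T \<Longrightarrow> contractible T \<Longrightarrow> contractible S"
  by (metis contractible_space_top_of_set homotopy_equivalent_space_contractibility)

lemma homotopy_eqv_nonempty: "S homotopy_eqv T \<Longrightarrow> T \<noteq> {} \<Longrightarrow> S \<noteq> {}"
  unfolding homotopy_equivalent_space_def by auto

text \<open>The negative condition is vacuous, so the straight line to the constant vector 1 stays
  in the space.\<close>

lemma contractible_sign_space_empty:
  assumes "P \<noteq> {}" "{} \<in> Q"
  shows "contractible (sign_space P Q :: ('i \<Rightarrow> real) set)" "sign_space P Q \<noteq> {}"
proof -
  show "sign_space P Q \<noteq> {}"
    using assms by (auto simp: sign_space_def intro!: exI[of _ "\<lambda>_. 1"])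
  have "homotopic_with_canon (\<lambda>_. True) (sign_space P Q) (sign_space P Q) id (\<lambda>_ _. 1)"
  proof (rule homotopic_canonI)
    show "continuous_on ({0..1} \<times> sign_space P Q) (\<lambda>q i. (1 - fst q) * snd q i + fst q)"
      by (intro continuous_intros continuous_on_product_then_coordinatewise[OF continuous_on_snd])
    fix t :: real and z assume t: "t \<in> {0..1}" and z: "z \<in> sign_space P Q"
    from z obtain A where A: "A \<in> P" "\<forall>i\<in>A. 0 < z i" by (auto simp: sign_space_def)
    have "0 < (1 - t) * z i + t" if "i \<in> A" for i
      using t A that by (cases "t = 1") (auto intro!: add_pos_nonneg)
    then show "(\<lambda>i. (1 - fst (t, z)) * snd (t, z) i + fst (t, z)) \<in> sign_space P Q"
      using A assms by (auto simp: sign_space_def)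
  qed auto
  then show "contractible (sign_space P Q)"
    unfolding contractible_def by blast
qed

lemma contractible_sign_space_split:
  assumes P: "finite P" "\<And>A. A \<in> P \<Longrightarrow> finite A" and Q: "finite Q" "\<And>B. B \<in> Q \<Longrightarrow> finite B"
    and "contractible (sign_space (removing x P) (avoiding x Q))"
    and "contractible (sign_space (avoiding x P) (removing x Q))"
    and "contractible (sign_space (avoiding x P) (avoiding x Q))" "sign_space (avoiding x P) (avoiding x Q) \<noteq> {}"
  shows "contractible (sign_space P Q)"
proof (rule collared_contractible[OF collared_sign_space[OF P Q, where x=x]])
  have "{z \<in> sign_space P Q. 0 \<le> z x} \<inter> {z \<in> sign_space P Q. z x \<le> 0} = {z \<in> sign_space P Q. z x = 0}"
    by auto
  then show "contractible ({z \<in> sign_space P Q. 0 \<le> z x} \<inter> {z \<in> sign_space P Q. z x \<le> 0})"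
    and "{z \<in> sign_space P Q. 0 \<le> z x} \<inter> {z \<in> sign_space P Q. z x \<le> 0} \<noteq> {}"
    using assms(7) homotopy_eqv_contractible[OF sign_space_zero] homotopy_eqv_nonempty[OF sign_space_zero assms(8)]
    by simp_all
qed (use homotopy_eqv_contractible[OF sign_space_nonneg assms(5)] homotopy_eqv_contractible[OF sign_space_nonpos assms(6)] in auto)

section \<open>Contractibility when one chain is ahead of the other\<close>

context
  fixes p :: "nat \<Rightarrow> nat" and k :: nat
  assumes gaps: "\<And>i. i \<in> {1..<k} \<Longrightarrow> p i + 2 \<le> p (Suc i)"
begin

lemma gaps_diff: "1 \<le> i \<Longrightarrow> i \<le> j \<Longrightarrow> j \<le> k \<Longrightarrow> p i + 2 * (j - i) \<le> p j"
proof (induction j)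
  case (Suc j)
  then show ?case using gaps[of j] by (cases "i = Suc j") (auto simp: Suc_diff_le)
qed simp

lemma strict_mono_on_positions: "1 \<le> i \<Longrightarrow> strict_mono_on {i..k} p"
proof (rule strict_mono_onI)
  fix r s assume "1 \<le> i" "r \<in> {i..k}" "s \<in> {i..k}" "r < s"
  then show "p r < p s" using gaps_diff[of r s] by auto
qed

text \<open>
  The position \<open>x\<close> scans from left to right. The positive chain is ahead of the negative one, since its slack
  \<open>\<gamma>\<close> is smaller than \<open>\<nu>\<close>, and each of the three pieces obtained by cutting at \<open>x\<close> is again of this form.
  The positive family \<open>P\<close> may contain further sets, which do no harm.
\<close>

lemma contractible_sign_space_chains:
  assumes "finite P" "\<And>A. A \<in> P \<Longrightarrow> finite A"
    and "1 \<le> i" "1 \<le> j"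
    and "i \<le> k \<longrightarrow> x \<le> p i + \<nu>" "j \<le> k \<longrightarrow> x \<le> p j + \<gamma>"
    and "\<gamma> < \<nu>" "\<nu> \<le> RN" "RN \<le> Suc RC"
    and "refines (slack_chains p k j \<gamma> RC) P"
  shows "contractible (sign_space P (slack_chains p k i \<nu> RN)) \<and> sign_space P (slack_chains p k i \<nu> RN) \<noteq> {}"
  using assms
proof (induction "Suc (p k + RN) - x" arbitrary: x i j \<nu> \<gamma> P rule: less_induct)
  case less
  note finP = less.prems(1,2) and pos = less.prems(3,4) and start = less.prems(5,6)
    and slack = less.prems(7-9) and ref = less.prems(10)
  show ?case
  proof (cases "k < i")
    case True
    \<comment> \<open>The slack hypotheses give \<open>\<gamma> \<le> RC\<close>, so the chain of
      constant slack \<open>\<gamma>\<close> exists and shows that \<open>P\<close> is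
      nonempty.\<close>
    have "(\<lambda>l. p l + \<gamma>) ` {j..k} \<in> slack_chains p k j \<gamma> RC"
      using slack by (auto simp: slack_chains_def intro!: exI[of _ "\<lambda>_. \<gamma>"] monotone_onI)
    then have "P \<noteq> {}" using ref by (auto simp: refines_def)
    then show ?thesis
      using contractible_sign_space_empty[of P "{{}}"] by (simp add: slack_chains_done[OF True])
  next
    case False
    then have ik: "i \<le> k" by simp
    have xi: "x \<le> p i + \<nu>" using start(1) ik by simp
    have "p i \<le> p k" using gaps_diff[of i k] pos ik by simp
    then have dec: "Suc (p k + RN) - Suc x < Suc (p k + RN) - x"
      using xi slack by simp
    let ?N = "slack_chains p k i \<nu> RN"
    have finN: "finite ?N" "\<And>B. B \<in> ?N \<Longrightarrow> finite B"
      by (auto intro: slack_chains_finite slack_chains_finite_member)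
    have finr: "finite (removing x P)" "\<And>A. A \<in> removing x P \<Longrightarrow> finite A"
      using finP by (auto simp: removing_def)
    have fina: "finite (avoiding x P)" "\<And>A. A \<in> avoiding x P \<Longrightarrow> finite A"
      using finP by (auto simp: avoiding_def)
    note pi = strict_mono_on_positions[OF pos(1)] and pj = strict_mono_on_positions[OF pos(2)]
    \<comment> \<open>If \<open>x\<close> is free for the positive side, a positive chain that could
      start at \<open>x\<close> gets this element at no cost: the index advances and the slack
      stays.\<close>
    obtain j' where j': "1 \<le> j'" "j' \<le> k \<longrightarrow> Suc x \<le> p j' + \<gamma>"
      and refr: "refines (slack_chains p k j' \<gamma> RC) (removing x P)"
    proof (cases "j \<le> k \<and> p j + \<gamma> = x")
      case True
      show thesis
      proof (rule that[of "Suc j"])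
        show "Suc j \<le> k \<longrightarrow> Suc x \<le> p (Suc j) + \<gamma>"
          using gaps[of j] pos True by auto
        show "refines (slack_chains p k (Suc j) \<gamma> RC) (removing x P)"
          using slack_chains_removing(1)[OF pj, of \<gamma> RC] refines_removing[OF ref, of x] True slack
          by (auto intro: refines_trans)
      qed simp
    next
      case False
      then show thesis
        using that[of j] pos start(2) refines_trans[OF ref removing_refines] by auto
    qed
    \<comment> \<open>If the positive side must avoid \<open>x\<close>, a chain that could start
      there loses one unit of slack.\<close>
    obtain \<gamma>' where \<gamma>': "j \<le> k \<longrightarrow> Suc x \<le> p j + \<gamma>'" "\<gamma>' \<le> Suc \<gamma>"
        "x = p i + \<nu> \<longrightarrow> \<gamma>' < \<nu>"
      and refa: "refines (slack_chains p k j \<gamma>' RC) (avoiding x P)"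
    proof (cases "j \<le> k \<and> p j + \<gamma> = x")
      case True
      show thesis
      proof (rule that[of "Suc \<gamma>"])
        \<comment> \<open>A collision of the two chains costs at least two units of slack, since all gaps are at least 2.\<close>
        show "x = p i + \<nu> \<longrightarrow> Suc \<gamma> < \<nu>"
        proof
          assume "x = p i + \<nu>"
          then have eq: "p j + \<gamma> = p i + \<nu>" using True by simp
          have "i < j"
            using gaps_diff[of j i] pos ik eq slack(1) by (cases "j \<le> i") auto
          then show "Suc \<gamma> < \<nu>"
            using gaps_diff[of i j] pos True eq by auto
        qed
        show "refines (slack_chains p k j (Suc \<gamma>) RC) (avoiding x P)"
          using slack_chains_avoiding[OF pj, of \<gamma> RC] refines_avoiding[OF ref, of x] True by auto
      qed (use True in auto)
    next
      case False
      then have "x \<notin> A" if "A \<in> slack_chains p k j \<gamma> RC" for A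
        using start(2) by (intro slack_chains_inactive[OF pj _ that]) auto
      then have "avoiding x (slack_chains p k j \<gamma> RC) = slack_chains p k j \<gamma> RC"
        by (auto simp: avoiding_def)
      then show thesis
        using that[of \<gamma>] start(2) slack False refines_avoiding[OF ref, of x] by auto
    qed
    show ?thesis
    proof (cases "x = p i + \<nu>")
      case False
      \<comment> \<open>No negative set uses \<open>x\<close>, so the space need not be cut and the
        positive side takes \<open>x\<close> for free.\<close>
      then have "x \<notin> B" if "B \<in> ?N" for B
        using xi by (intro slack_chains_inactive[OF pi _ that]) auto
      then have eqv: "sign_space P ?N homotopy_eqv sign_space (removing x P) ?N"
        by (rule sign_space_removing)
      have "contractible (sign_space (removing x P) ?N) \<and> sign_space (removing x P) ?N \<noteq> {}"
        by (rule less.hyps[OF dec finr pos(1) j'(1) _ j'(2) slack refr]) (use xi False in auto)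
      then show ?thesis
        using homotopy_eqv_contractible[OF eqv] homotopy_eqv_nonempty[OF eqv] by blast
    next
      case True
      have N_avoid: "avoiding x ?N = slack_chains p k i (Suc \<nu>) RN"
        unfolding True by (rule slack_chains_avoiding[OF pi ik])
      \<comment> \<open>In the half \<open>z x \<le> 0\<close> the negative chain places its
        \<open>i\<close>-th element at \<open>x\<close> and keeps its slack. The positive lead
        survives by \<open>\<gamma>' < \<nu>\<close>.\<close>
      have "contractible (sign_space (avoiding x P) (slack_chains p k (Suc i) \<nu> RN)) \<and>
          sign_space (avoiding x P) (slack_chains p k (Suc i) \<nu> RN) \<noteq> {}"
      proof (rule less.hyps[OF dec fina _ pos(2) _ \<gamma>'(1) _ slack(2,3) refa])
        show "Suc i \<le> k \<longrightarrow> Suc x \<le> p (Suc i) + \<nu>"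
          using gaps[of i] pos True by auto
      qed (use \<gamma>'(3) True in auto)
      moreover have "sign_space (avoiding x P) (slack_chains p k (Suc i) \<nu> RN) = sign_space (avoiding x P) (removing x ?N)"
        unfolding True by (intro sign_space_eq refines_refl slack_chains_removing pi ik slack(2))
      ultimately have low: "contractible (sign_space (avoiding x P) (removing x ?N))"
          "sign_space (avoiding x P) (removing x ?N) \<noteq> {}"
        by simp_all
      show ?thesis
      proof (cases "\<nu> = RN")
        case True
        \<comment> \<open>Without slack every negative chain contains \<open>x\<close>, so the half
          \<open>0 \<le> z x\<close> is empty and the other half is the whole space.\<close>
        have "avoiding x ?N = {}"
          unfolding N_avoid by (rule slack_chains_empty[OF ik]) (simp add: True)
        then have "sign_space (removing x P) (avoiding x ?N) = {}"
          by (simp add: sign_space_def)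
        then have "{z \<in> sign_space P ?N. 0 \<le> z x} = {}"
          using homotopy_eqv_nonempty[OF homotopy_equivalent_space_sym[THEN iffD1, OF sign_space_nonneg[of P ?N x]]]
          by (rule contrapos_pp)
        then have "{z \<in> sign_space P ?N. z x \<le> 0} = sign_space P ?N"
          by force
        then have eqv: "sign_space P ?N homotopy_eqv sign_space (avoiding x P) (removing x ?N)"
          using sign_space_nonpos[of P ?N x] by simp
        show ?thesis
          using homotopy_eqv_contractible[OF eqv low(1)] homotopy_eqv_nonempty[OF eqv low(2)] by blast
      next
        case False
        \<comment> \<open>In the two remaining pieces the negative chain loses a unit; since
          \<open>\<gamma>' \<le> Suc \<gamma> < Suc \<nu>\<close>, the lead survives even if the
          positive chain loses one as well.\<close>
        then have S: "Suc \<nu> \<le> RN" using slack(2) by simp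
        have "contractible (sign_space (removing x P) (slack_chains p k i (Suc \<nu>) RN))"
          using less.hyps[OF dec finr pos(1) j'(1) _ j'(2) _ S slack(3) refr] slack True by simp
        moreover have "contractible (sign_space (avoiding x P) (slack_chains p k i (Suc \<nu>) RN)) \<and>
            sign_space (avoiding x P) (slack_chains p k i (Suc \<nu>) RN) \<noteq> {}"
          using less.hyps[OF dec fina pos _ \<gamma>'(1) _ S slack(3) refa] \<gamma>' slack(1) True by simp
        ultimately have "contractible (sign_space P ?N)" and z: "sign_space (avoiding x P) (avoiding x ?N) \<noteq> {}"
          using contractible_sign_space_split[OF finP finN, of x] low(1) by (simp_all add: N_avoid)
        then show ?thesis
          using homotopy_eqv_nonempty[OF sign_space_zero z] by blast
      qed
    qed
  qed
qed

end

subsection \<open>Spheres as suspensions\<close>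

text \<open>Indexed by the number of coordinates, one more than the dimension, so that the count of
  suspensions starts with the empty space at 0.\<close>

definition unit_sphere :: "nat \<Rightarrow> (nat \<Rightarrow> real) set" where
  "unit_sphere d = {x. (\<Sum>i<d. (x i)\<^sup>2) = 1 \<and> (\<forall>i\<ge>d. x i = 0)}"

lemma unit_sphere_0: "unit_sphere 0 = {}"
  by (simp add: unit_sphere_def)

lemma nsphere_eq_unit_sphere: "nsphere n = top_of_set (unit_sphere (Suc n))"
  unfolding nsphere unit_sphere_def lessThan_Suc_atMost Suc_le_eq euclidean_product_topology ..

lemma normalize_unit_sphere:
  assumes "(\<Sum>i<d. (y i)\<^sup>2) = N" "0 < N" "\<And>i. d \<le> i \<Longrightarrow> y i = 0"
  shows "(\<lambda>i. y i / sqrt N) \<in> unit_sphere d"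
  using assms by (auto simp: unit_sphere_def power_divide simp flip: sum_divide_distrib)

lemma unit_sphere_last:
  "x \<in> unit_sphere (Suc d) \<Longrightarrow> (\<Sum>i<d. (x i)\<^sup>2) = 1 - (x d)\<^sup>2"
  by (simp add: unit_sphere_def)

lemma unit_sphere_equator:
  "{x \<in> unit_sphere (Suc d). 0 \<le> x d} \<inter> {x \<in> unit_sphere (Suc d). x d \<le> 0} = unit_sphere d"
  by (auto simp: unit_sphere_def le_Suc_eq Suc_le_eq) (metis le_neq_implies_less)

text \<open>The segment to the pole \<open>e\<close> is projected radially back to the sphere; on
  the hemisphere of that pole it misses the origin. The sign \<open>\<sigma>\<close> covers both
  hemispheres.\<close>

lemma contractible_hemisphere:
  assumes \<sigma>: "\<sigma> = 1 \<or> \<sigma> = - (1::real)"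
  shows "contractible {x \<in> unit_sphere (Suc d). 0 \<le> \<sigma> * x d}" (is "contractible ?H")
    and "{x \<in> unit_sphere (Suc d). 0 \<le> \<sigma> * x d} \<noteq> {}"
proof -
  have \<sigma>2: "\<sigma>\<^sup>2 = 1" "\<sigma> * \<sigma> = 1" using \<sigma> by auto
  define e where "e = (\<lambda>i. if i = d then \<sigma> else 0)"
  have "e \<in> ?H"
    using \<sigma>2 by (auto simp: e_def unit_sphere_def)
  then show "?H \<noteq> {}" by blast
  \<comment> \<open>The squared norm of the point \<open>(1 - t) x + t e\<close> of the
    segment.\<close>
  define N where "N t x = (1 - t)\<^sup>2 + 2 * t * (1 - t) * (\<sigma> * x d) + t\<^sup>2" for t :: real and x :: "nat \<Rightarrow> real"
  have N: "0 < N t x" if "x \<in> ?H" "t \<in> {0..1}" for t x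
  proof -
    have "0 < (1 - t)\<^sup>2 + t\<^sup>2"
      by (cases "t = 0") (auto intro: add_nonneg_pos)
    moreover have "0 \<le> 2 * t * (1 - t) * (\<sigma> * x d)"
      using that by (intro mult_nonneg_nonneg[of "2 * t * (1 - t)"]) auto
    ultimately show ?thesis unfolding N_def by linarith
  qed
  have "homotopic_with_canon (\<lambda>_. True) ?H ?H id (\<lambda>_. e)"
  proof (rule homotopic_canonI)
    show "continuous_on ({0..1} \<times> ?H) (\<lambda>q i. ((1 - fst q) * snd q i + fst q * e i) / sqrt (N (fst q) (snd q)))"
      unfolding N_def
      by (intro continuous_intros continuous_on_product_then_coordinatewise[OF continuous_on_snd])
        (use N in \<open>fastforce simp: N_def\<close>)
    fix t x assume t: "t \<in> {0..1::real}" and x: "x \<in> ?H"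
    have "(\<Sum>i<d. ((1 - t) * x i + t * e i)\<^sup>2) = (\<Sum>i<d. (1 - t)\<^sup>2 * (x i)\<^sup>2)"
      by (intro sum.cong) (auto simp: e_def power_mult_distrib)
    also have "\<dots> = (1 - t)\<^sup>2 * (1 - (x d)\<^sup>2)"
      using x by (simp add: unit_sphere_last flip: sum_distrib_left)
    finally have "(\<Sum>i<Suc d. ((1 - t) * x i + t * e i)\<^sup>2) = N t x"
      using \<sigma>2 by (simp add: N_def e_def power2_sum power_mult_distrib) (simp add: algebra_simps)
    then have "(\<lambda>i. ((1 - t) * x i + t * e i) / sqrt (N t x)) \<in> unit_sphere (Suc d)"
      by (rule normalize_unit_sphere) (use x N[OF x t] in \<open>auto simp: e_def unit_sphere_def\<close>)
    moreover have "0 \<le> \<sigma> * (((1 - t) * x d + t * e d) / sqrt (N t x))"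
    proof -
      have "\<sigma> * ((1 - t) * x d + t * e d) = (1 - t) * (\<sigma> * x d) + t * (\<sigma> * \<sigma>)"
        by (simp add: e_def algebra_simps)
      also have "\<dots> \<ge> 0"
        using t x \<sigma>2 by (simp add: mult_nonneg_nonneg[of "1 - t"])
      finally show ?thesis using N[OF x t] by simp
    qed
    ultimately show "(\<lambda>i. ((1 - fst (t, x)) * snd (t, x) i + fst (t, x) * e i) / sqrt (N (fst (t, x)) (snd (t, x)))) \<in> ?H"
      by simp
  qed (auto simp: N_def)
  then show "contractible ?H"
    unfolding contractible_def by blast
qed

lemma collared_unit_sphere:
  "collared (unit_sphere (Suc d)) {x \<in> unit_sphere (Suc d). 0 \<le> x d} {x \<in> unit_sphere (Suc d). x d \<le> 0}"
proof -
  let ?S = "unit_sphere (Suc d)"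
  define D where "D = {x \<in> ?S. \<bar>x d\<bar> \<le> 1/2}"
  define u where "u x = min 1 (2 * \<bar>x d\<bar>)" for x :: "nat \<Rightarrow> real"
  \<comment> \<open>The squared norm after the last coordinate is scaled by \<open>1 - t\<close>.
    The bound 1/2 in \<open>D\<close> keeps away from the poles, so it stays positive.\<close>
  define N where "N t x = 1 - (x d)\<^sup>2 + ((1 - t) * x d)\<^sup>2" for t :: real and x :: "nat \<Rightarrow> real"
  define M where "M = (\<lambda>(t, x) i. (x(d := (1 - t) * x d)) i / sqrt (N t x))"
  have N: "0 < N t x" if "x \<in> D" for t x
  proof -
    have "(x d)\<^sup>2 \<le> (1/2)\<^sup>2"
      using that by (subst abs_le_square_iff[symmetric]) (simp add: D_def)
    then show ?thesis by (auto simp: N_def power2_eq_square[of "1/2::real"] intro: add_pos_nonneg)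
  qed
  have MS: "M (t, x) \<in> ?S" if "x \<in> D" for t x
    unfolding M_def prod.case
  proof (rule normalize_unit_sphere)
    have "(\<Sum>i<d. ((x(d := (1 - t) * x d)) i)\<^sup>2) = (\<Sum>i<d. (x i)\<^sup>2)"
      by (intro sum.cong) auto
    then show "(\<Sum>i<Suc d. ((x(d := (1 - t) * x d)) i)\<^sup>2) = N t x"
      using that by (simp add: N_def D_def unit_sphere_last)
    show "0 < N t x" by (rule N[OF that])
  qed (use that in \<open>auto simp: D_def unit_sphere_def\<close>)
  have Deq: "D = ?S \<inter> {x. \<bar>x d\<bar> \<le> 1/2}" by (auto simp: D_def)
  have Dcl: "closedin (top_of_set ?S) D"
    unfolding Deq by (intro closedin_closed_Int closed_Collect_le continuous_intros)
  have Aeq: "{x \<in> ?S. 0 \<le> x d} = ?S \<inter> {x. 0 \<le> x d}" "{x \<in> ?S. x d \<le> 0} = ?S \<inter> {x. x d \<le> 0}" by auto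
  have cl: "closedin (top_of_set ?S) {x \<in> ?S. 0 \<le> x d}" "closedin (top_of_set ?S) {x \<in> ?S. x d \<le> 0}"
    unfolding Aeq by (intro closedin_closed_Int closed_Collect_le continuous_intros)+
  have cu: "continuous_on ?S u"
    unfolding u_def by (intro continuous_intros)
  have cM: "continuous_on ({0..1} \<times> D) M"
    unfolding M_def case_prod_beta
  proof (intro continuous_on_coordinatewise_then_product continuous_on_divide continuous_on_real_sqrt)
    show "continuous_on ({0..1} \<times> D) (\<lambda>q. N (fst q) (snd q))"
      unfolding N_def
      by (intro continuous_intros continuous_on_product_then_coordinatewise[OF continuous_on_snd])
    show "\<forall>q\<in>{0..1} \<times> D. sqrt (N (fst q) (snd q)) \<noteq> 0"
      using N by (metis SigmaD2 less_irrefl prod.collapse real_sqrt_eq_zero_cancel_iff)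
    show "continuous_on ({0..1} \<times> D) (\<lambda>q. ((snd q)(d := (1 - fst q) * snd q d)) i)" for i
      by (intro continuous_on_product_then_coordinatewise[OF continuous_on_fun_upd] continuous_intros
        continuous_on_product_then_coordinatewise[OF continuous_on_snd])
  qed
  have N1: "N 0 x = 1" "x d = 0 \<Longrightarrow> N t x = 1" for t x by (simp_all add: N_def)
  show ?thesis
  proof (rule collaredI[where u=u and D=D and M=M])
    show "M (t, x) \<in> {x \<in> ?S. 0 \<le> x d}" if "0 \<le> t" "t \<le> 1" "x \<in> {x \<in> ?S. 0 \<le> x d} \<inter> D" for t x
      using that MS N[of x t] by (auto simp: M_def intro!: divide_nonneg_pos)
    show "M (t, x) \<in> {x \<in> ?S. x d \<le> 0}" if "0 \<le> t" "t \<le> 1" "x \<in> {x \<in> ?S. x d \<le> 0} \<inter> D" for t x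
      using that MS N[of x t] by (auto simp: M_def intro!: divide_nonpos_pos mult_nonneg_nonpos)
    show "M (0, x) = x" if "x \<in> D" for x
      by (simp add: M_def N1 fun_eq_iff)
    show "M (1, x) \<in> {x \<in> ?S. 0 \<le> x d} \<inter> {x \<in> ?S. x d \<le> 0}" if "x \<in> D" for x
      using MS[OF that, of 1] by (simp add: M_def)
    show "M (1, x) = x" if "x \<in> {x \<in> ?S. 0 \<le> x d} \<inter> {x \<in> ?S. x d \<le> 0}" for x
      using that by (auto simp: M_def N1 fun_eq_iff)
  qed (use cu Dcl cM cl in \<open>auto simp: u_def D_def\<close>)
qed

text \<open>With the same family on both sides, negation exchanges the two halves, so one
  contractible half suffices.\<close>

lemma sign_space_suspension:
  assumes P: "finite P" "\<And>A. A \<in> P \<Longrightarrow> finite A"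
    and half: "contractible (sign_space (removing x P) (avoiding x P))" "sign_space (removing x P) (avoiding x P) \<noteq> {}"
    and eq: "sign_space (avoiding x P) (avoiding x P) homotopy_eqv unit_sphere d"
  shows "sign_space P P homotopy_eqv unit_sphere (Suc d)"
proof (rule collared_homotopy_eqv[OF collared_sign_space[OF P P, where x=x] collared_unit_sphere])
  let ?A = "{z \<in> sign_space P P. 0 \<le> z x}" and ?B = "{z \<in> sign_space P P. z x \<le> 0}"
  show A: "contractible ?A" "?A \<noteq> {}"
    using homotopy_eqv_contractible[OF sign_space_nonneg half(1)] homotopy_eqv_nonempty[OF sign_space_nonneg half(2)] .
  show "contractible ?B" "?B \<noteq> {}"
    using homotopy_eqv_contractible[OF sign_space_swap_halfspace A(1)]
      homotopy_eqv_nonempty[OF sign_space_swap_halfspace A(2)] .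
  have "?A \<inter> ?B = {z \<in> sign_space P P. z x = 0}" by auto
  then show "?A \<inter> ?B homotopy_eqv {x \<in> unit_sphere (Suc d). 0 \<le> x d} \<inter> {x \<in> unit_sphere (Suc d). x d \<le> 0}"
    using homotopy_eqv_trans[OF sign_space_zero eq] by (simp add: unit_sphere_equator)
qed (use contractible_hemisphere[of 1 d] contractible_hemisphere[of "-1" d] in simp_all)

lemma homotopy_eqv_empty: "S = {} \<Longrightarrow> T = {} \<Longrightarrow> S homotopy_eqv T"
  by (rule homeomorphic_imp_homotopy_eqv) simp

text \<open>Each cut at the leftmost available position uses one unit of slack. In a half, one side
  has that element for free while the other has lost a unit, which is the lead that makes it
  contractible.\<close>

lemma sign_space_chains_sphere:
  assumes gaps: "\<And>i. i \<in> {1..<k} \<Longrightarrow> p i + 2 \<le> p (Suc i)" and "1 \<le> k" "a \<le> R"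
  shows "sign_space (slack_chains p k 1 a R) (slack_chains p k 1 a R) homotopy_eqv unit_sphere (R - a)"
  using \<open>a \<le> R\<close>
proof (induction "R - a" arbitrary: a)
  case 0
  then have "a = R" by simp
  \<comment> \<open>Without slack the chain is unique, and its first element cannot be both positive
    and negative.\<close>
  have "p 1 + R \<in> A" if "A \<in> slack_chains p k 1 R R" for A
    using that \<open>1 \<le> k\<close> by (force simp: slack_chains_def)
  then have "sign_space (slack_chains p k 1 R R) (slack_chains p k 1 R R) = {}"
    by (auto elim!: sign_spaceE) (metis less_asym)
  then show ?case
    by (intro homotopy_eqv_empty) (simp_all add: \<open>a = R\<close> unit_sphere_0)
next
  case (Suc d)
  let ?C = "slack_chains p k 1 a R" and ?x = "p 1 + a"
  have p: "strict_mono_on {1..k} p"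
    using strict_mono_on_positions[of k p, OF gaps] by simp
  have avoid: "avoiding ?x ?C = slack_chains p k 1 (Suc a) R"
    by (rule slack_chains_avoiding[OF p \<open>1 \<le> k\<close>])
  have "contractible (sign_space (removing ?x ?C) (avoiding ?x ?C)) \<and>
      sign_space (removing ?x ?C) (avoiding ?x ?C) \<noteq> {}"
    unfolding avoid
  proof (rule contractible_sign_space_chains[of k p, OF gaps, where j=2 and \<gamma>=a and RC=R and x="Suc ?x"])
    show "refines (slack_chains p k 2 a R) (removing ?x ?C)"
      using slack_chains_removing(1)[OF p \<open>1 \<le> k\<close> Suc.prems] by (simp add: numeral_2_eq_2)
    show "2 \<le> k \<longrightarrow> Suc ?x \<le> p 2 + a"
      using gaps[of 1] by (auto simp: numeral_2_eq_2)
  qed (use Suc in \<open>auto simp: removing_def slack_chains_finite dest: slack_chains_finite_member\<close>)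
  moreover have "sign_space (avoiding ?x ?C) (avoiding ?x ?C) homotopy_eqv unit_sphere d"
  proof -
    have d: "d = R - Suc a" "Suc a \<le> R" using Suc.hyps(2) by auto
    show ?thesis
      unfolding avoid using Suc.hyps(1)[OF d] by (simp only: d(1))
  qed
  ultimately have "sign_space ?C ?C homotopy_eqv unit_sphere (Suc d)"
    by (intro sign_space_suspension[where x="?x"] slack_chains_finite) (auto dest: slack_chains_finite_member)
  then show ?case using Suc.hyps(2) by simp
qed

text \<open>The cut at \<open>p 1\<close> is separate because the members of \<open>S\<close>
  through \<open>p 1\<close> need not form a chain family. Having the chains with slack up to
  \<open>R - 1\<close> among them is enough, by the tolerance \<open>RN \<le> Suc RC\<close> in
  \<open>contractible_sign_space_chains\<close>.\<close>

lemma sign_space_sphere: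
  assumes gaps: "\<And>i. i \<in> {1..<k} \<Longrightarrow> p i + 2 \<le> p (Suc i)" and "1 \<le> k" "1 \<le> R"
    and S: "finite S" "\<And>A. A \<in> S \<Longrightarrow> finite A"
    and avoid: "avoiding (p 1) S = slack_chains p k 1 1 R"
    and ref: "refines (slack_chains p k 2 0 (R - 1)) (removing (p 1) S)"
  shows "sign_space S S homotopy_eqv unit_sphere R"
proof -
  have "contractible (sign_space (removing (p 1) S) (avoiding (p 1) S)) \<and>
      sign_space (removing (p 1) S) (avoiding (p 1) S) \<noteq> {}"
    unfolding avoid
  proof (rule contractible_sign_space_chains[of k p, OF gaps _ _ _ _ _ _ _ _ _ ref, where x="Suc (p 1)"])
    show "2 \<le> k \<longrightarrow> Suc (p 1) \<le> p 2 + 0"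
      using gaps[of 1] by (auto simp: numeral_2_eq_2)
  qed (use S \<open>1 \<le> R\<close> in \<open>auto simp: removing_def\<close>)
  moreover have "sign_space (avoiding (p 1) S) (avoiding (p 1) S) homotopy_eqv unit_sphere (R - 1)"
    unfolding avoid by (rule sign_space_chains_sphere[of k p, OF gaps assms(2,3)])
  ultimately have "sign_space S S homotopy_eqv unit_sphere (Suc (R - 1))"
    by (intro sign_space_suspension[where x="p 1"] S) auto
  then show ?thesis using \<open>1 \<le> R\<close> by simp
qed

subsection \<open>The neighborhood complex as a space of sign vectors\<close>

lemma homotopic_segment:
  fixes f :: "('i \<Rightarrow> real) \<Rightarrow> 'i \<Rightarrow> real"
  assumes "continuous_on S f"
    and "\<And>x t. x \<in> S \<Longrightarrow> 0 \<le> t \<Longrightarrow> t \<le> 1 \<Longrightarrow> (\<lambda>i. (1 - t) * f x i + t * x i) \<in> S"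
  shows "homotopic_with_canon (\<lambda>_. True) S S f (\<lambda>x. x)"
proof (rule homotopic_canonI)
  have "continuous_on ({0..1::real} \<times> S) (\<lambda>q. f (snd q))"
    by (rule continuous_on_compose2[OF assms(1) continuous_on_snd[OF continuous_on_id]]) auto
  then have c1: "continuous_on ({0..1::real} \<times> S) (\<lambda>q. f (snd q) i)" for i
    by (rule continuous_on_product_then_coordinatewise)
  have "continuous_on ({0..1::real} \<times> S) snd"
    by (rule continuous_on_snd[OF continuous_on_id])
  then have c2: "continuous_on ({0..1::real} \<times> S) (\<lambda>q. snd q i)" for i
    by (rule continuous_on_product_then_coordinatewise)
  show "continuous_on ({0..1} \<times> S) (\<lambda>q i. (1 - fst q) * f (snd q) i + fst q * snd q i)"
  proof (rule continuous_on_coordinatewise_then_product)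
    show "continuous_on ({0..1} \<times> S) (\<lambda>q. (1 - fst q) * f (snd q) i + fst q * snd q i)" for i
      by (rule continuous_on_add[OF continuous_on_mult[OF _ c1] continuous_on_mult[OF _ c2]])
        (intro continuous_on_diff continuous_on_const continuous_on_fst continuous_on_id)+
  qed
qed (use assms(2) in auto)

text \<open>The map back, \<open>g\<close>, gives each point the total weight of the sets through
  it, lowered by \<open>\<epsilon>\<close>. Both composites are joined to the identity by segments,
  because a point and its image share the sets that witness membership.\<close>

lemma realization_homotopy_eqv_sign_space:
  fixes S :: "'i set set"
  assumes S: "finite S" "\<And>A. A \<in> S \<Longrightarrow> finite A"
  defines "K \<equiv> {T. T \<subseteq> S \<and> (\<exists>B\<in>S. \<forall>A\<in>T. A \<inter> B = {})}"
  shows "{x :: 'i set \<Rightarrow> real. (\<forall>v. 0 \<le> x v) \<and> {v. x v \<noteq> 0} \<in> K \<and> (\<Sum>v | x v \<noteq> 0. x v) = 1}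
    homotopy_eqv sign_space S S" (is "?R homotopy_eqv ?W")
proof -
  have R_iff: "x \<in> ?R \<longleftrightarrow> (\<forall>A. 0 \<le> x A) \<and> (\<forall>A. x A \<noteq> 0 \<longrightarrow> A \<in> S) \<and>
      (\<exists>B\<in>S. \<forall>A. x A \<noteq> 0 \<longrightarrow> A \<inter> B = {}) \<and> sum x S = 1" for x :: "'i set \<Rightarrow> real"
  proof -
    have "(\<Sum>v | x v \<noteq> 0. x v) = sum x S" if "{v. x v \<noteq> 0} \<subseteq> S"
      using that S(1) by (intro sum.mono_neutral_left) auto
    then show ?thesis
      by (cases "{v. x v \<noteq> 0} \<subseteq> S") (simp_all add: K_def, auto)
  qed
  \<comment> \<open>Half the average weight: some set weighs more than \<open>\<epsilon>\<close>, so
    \<open>g\<close> is positive on it, while on a common neighbour of the support \<open>g\<close>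
    equals \<open>-\<epsilon>\<close>.\<close>
  define \<epsilon> where "\<epsilon> = 1 / (2 * real (card S))"
  define f where "f z = (\<lambda>A. if A \<in> S then (\<Prod>i\<in>A. max 0 (z i)) / monomial_sum S z else 0)" for z :: "'i \<Rightarrow> real"
  define g where "g x = (\<lambda>i. (\<Sum>A\<in>S. if i \<in> A then x A else 0) - \<epsilon>)" for x :: "'i set \<Rightarrow> real"
  have \<epsilon>: "0 < \<epsilon>" if "A \<in> S" for A
    using that S(1) by (auto simp: \<epsilon>_def card_gt_0_iff)
  have f_pos: "A \<in> S \<and> (\<forall>i\<in>A. 0 < z i)" if "f z A \<noteq> 0" for z A
  proof -
    have "A \<in> S" "(\<Prod>i\<in>A. max 0 (z i)) \<noteq> 0"
      using that by (auto simp: f_def split: if_splits)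
    then show ?thesis
      using S(2)[of A] by (auto simp: max_def not_le split: if_splits)
  qed
  have f_mem: "f z \<in> ?R" if z: "z \<in> ?W" for z
  proof -
    obtain A B where AB: "A \<in> S" "B \<in> S" "\<forall>i\<in>A. 0 < z i" "\<forall>i\<in>B. z i < 0"
      using z by (rule sign_spaceE)
    have pos: "0 < monomial_sum S z"
      using AB S by (auto simp: monomial_sum_pos_iff)
    have "sum (f z) S = (\<Sum>A\<in>S. \<Prod>i\<in>A. max 0 (z i)) / monomial_sum S z"
      by (simp add: f_def sum_divide_distrib)
    then have "sum (f z) S = 1"
      using pos by (simp add: monomial_sum_def)
    moreover have "0 \<le> f z A" for A
      using pos by (auto simp: f_def intro!: divide_nonneg_pos prod_nonneg)
    moreover have "A \<inter> B = {}" if "f z A \<noteq> 0" for A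
      using f_pos[OF that] AB(4) by force
    ultimately show ?thesis
      unfolding R_iff using f_pos AB(2) by blast
  qed
  have g_neg: "g x i < 0" if "B \<in> S" "\<forall>A. x A \<noteq> 0 \<longrightarrow> A \<inter> B = {}" "i \<in> B" for x B i
  proof -
    have "(\<Sum>A\<in>S. if i \<in> A then x A else 0) = 0"
      using that by (intro sum.neutral) auto
    then show ?thesis using \<epsilon>[OF that(1)] by (simp add: g_def)
  qed
  have g_mem: "g x \<in> ?W" if xR: "x \<in> ?R" for x
  proof -
    obtain B where x: "\<forall>A. 0 \<le> x A" "B \<in> S" "\<forall>A. x A \<noteq> 0 \<longrightarrow> A \<inter> B = {}" "sum x S = 1"
      using xR unfolding R_iff by blast
    have "\<exists>A\<in>S. \<epsilon> < x A"
    proof (rule ccontr)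
      assume "\<not> (\<exists>A\<in>S. \<epsilon> < x A)"
      then have "sum x S \<le> real (card S) * \<epsilon>"
        by (intro sum_bounded_above) force
      also have "\<dots> < 1"
        using x(2) S(1) by (auto simp: \<epsilon>_def)
      finally show False using x(4) by simp
    qed
    then obtain A where A: "A \<in> S" "\<epsilon> < x A" by blast
    show ?thesis
    proof (rule sign_spaceI[OF A(1) x(2)])
      fix i assume "i \<in> A"
      have "x A \<le> (\<Sum>A\<in>S. if i \<in> A then x A else 0)"
        using member_le_sum[of A S "\<lambda>A. if i \<in> A then x A else 0"] A(1) S(1) x(1) \<open>i \<in> A\<close> by auto
      then show "0 < g x i" using A(2) by (simp add: g_def)
    qed (use g_neg x in blast)
  qed
  have cg: "continuous_on ?R g"
    unfolding g_def
  proof (intro continuous_on_coordinatewise_then_product continuous_on_diff continuous_on_sum continuous_on_const)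
    show "continuous_on ?R (\<lambda>x. if i \<in> A then x A else 0)" for i A
      by (cases "i \<in> A") (simp_all add: continuous_on_coordinate)
  qed
  have cf: "continuous_on ?W f"
  proof (rule continuous_on_coordinatewise_then_product)
    fix A
    have "\<forall>z\<in>?W. monomial_sum S z \<noteq> 0"
      using S by (metis less_irrefl monomial_sum_pos_iff sign_spaceE)
    then have "continuous_on ?W (\<lambda>z. (\<Prod>i\<in>A. max 0 (z i)) / monomial_sum S z)"
      by (intro continuous_intros)
    then show "continuous_on ?W (\<lambda>z. f z A)"
      by (cases "A \<in> S") (simp_all add: f_def)
  qed
  show ?thesis
  proof (rule homotopy_eqvI[OF cg _ cf])
    show "homotopic_with_canon (\<lambda>_. True) ?R ?R (\<lambda>x. f (g x)) (\<lambda>x. x)"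
    proof (rule homotopic_segment)
      show "continuous_on ?R (\<lambda>x. f (g x))"
        using continuous_on_compose2[OF cf cg] g_mem by blast
      fix x and t :: real assume x: "x \<in> ?R" and t: "0 \<le> t" "t \<le> 1"
      obtain B where B: "B \<in> S" "\<forall>A. x A \<noteq> 0 \<longrightarrow> A \<inter> B = {}" and x': "\<forall>A. 0 \<le> x A" "sum x S = 1"
          "\<forall>A. x A \<noteq> 0 \<longrightarrow> A \<in> S"
        using x unfolding R_iff by blast
      have y: "f (g x) \<in> ?R" using x by (intro f_mem g_mem)
      then have y': "\<forall>A. 0 \<le> f (g x) A" "sum (f (g x)) S = 1"
        unfolding R_iff by blast+
      \<comment> \<open>The same neighbour \<open>B\<close> serves both ends of the segment:
        \<open>g x\<close> is negative on \<open>B\<close>, so sets meeting \<open>B\<close> get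
        weight 0.\<close>
      have fB: "A \<inter> B = {}" if "f (g x) A \<noteq> 0" for A
        using f_pos[OF that] g_neg[OF B] by force
      show "(\<lambda>A. (1 - t) * f (g x) A + t * x A) \<in> ?R"
        unfolding R_iff
      proof (intro conjI allI impI)
        show "0 \<le> (1 - t) * f (g x) A + t * x A" for A
          using y' x' t by (auto intro!: add_nonneg_nonneg mult_nonneg_nonneg)
        show "A \<in> S" if "(1 - t) * f (g x) A + t * x A \<noteq> 0" for A
          using that x'(3) f_pos[of "g x" A] by force
        have "A \<inter> B = {}" if "(1 - t) * f (g x) A + t * x A \<noteq> 0" for A
          using that B(2) fB[of A] by (cases "x A = 0"; cases "f (g x) A = 0") auto
        then show "\<exists>B\<in>S. \<forall>A. (1 - t) * f (g x) A + t * x A \<noteq> 0 \<longrightarrow> A \<inter> B = {}"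
          using B(1) by blast
        show "(\<Sum>A\<in>S. (1 - t) * f (g x) A + t * x A) = 1"
          using x' y' by (simp add: sum.distrib flip: sum_distrib_left)
      qed
    qed
    show "homotopic_with_canon (\<lambda>_. True) ?W ?W (\<lambda>z. g (f z)) (\<lambda>z. z)"
    proof (rule homotopic_segment)
      show "continuous_on ?W (\<lambda>z. g (f z))"
        using continuous_on_compose2[OF cg cf] f_mem by blast
      fix z and t :: real assume z: "z \<in> ?W" and t: "0 \<le> t" "t \<le> 1"
      obtain B where B: "B \<in> S" "\<forall>i\<in>B. z i < 0"
        using z by (rule sign_spaceE)
      obtain A where A: "A \<in> S" "\<forall>i\<in>A. 0 < g (f z) i"
        using g_mem[OF f_mem[OF z]] by (rule sign_spaceE)
      \<comment> \<open>Signs compare in one direction only. Hence the positive witness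
        \<open>A\<close> is taken from \<open>g (f z)\<close> and the negative witness
        \<open>B\<close> from \<open>z\<close>.\<close>
      have gz: "0 < z i" if "0 \<le> g (f z) i" for i
      proof (rule ccontr)
        assume "\<not> 0 < z i"
        then have "(\<Sum>A\<in>S. if i \<in> A then f z A else 0) = 0"
          using f_pos by (intro sum.neutral) force
        then show False using that \<epsilon>[OF A(1)] by (simp add: g_def)
      qed
      show "(\<lambda>i. (1 - t) * g (f z) i + t * z i) \<in> ?W"
      proof (rule sign_spaceI[OF A(1) B(1)])
        fix i assume "i \<in> A"
        then have "0 < g (f z) i" "0 < z i" using A(2) gz[of i] by auto
        then show "0 < (1 - t) * g (f z) i + t * z i"
          using t by (cases "t = 0") (auto intro!: add_nonneg_pos)
      next
        fix i assume "i \<in> B"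
        then have "z i < 0" "g (f z) i < 0" using B(2) gz[of i] by force+
        then show "(1 - t) * g (f z) i + t * z i < 0"
          using t by (cases "t = 0") (auto intro!: add_nonpos_neg mult_nonneg_nonpos mult_pos_neg)
      qed
    qed
  qed (use f_mem g_mem in blast)+
qed

subsection \<open>Stable sets as chains\<close>

lemma kth_element_image:
  assumes "strict_mono_on {1..k} h" "l \<in> {1..k}"
  shows "kth_element (h ` {1..k}) l = h l"
proof -
  have "sorted_wrt (<) (map h [1..<Suc k])"
    using assms(1) by (auto simp: sorted_wrt_iff_nth_less simp del: upt_Suc intro!: strict_mono_onD[of "{1..k}" h])
  then have "sorted_list_of_set (set (map h [1..<Suc k])) = map h [1..<Suc k]"
    by (intro sorted_list_of_set.idem_if_sorted_distinct) (simp_all add: strict_sorted_iff)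
  then have "sorted_list_of_set (h ` {1..k}) = map h [1..<Suc k]"
    by (simp add: atLeastLessThanSuc_atLeastAtMost del: upt_Suc)
  then show ?thesis
    using assms(2) by (auto simp: kth_element_def nth_append simp del: upt_Suc)
qed

lemma image_kth_element:
  assumes "finite A"
  shows "kth_element A ` {1..card A} = A"
proof -
  have "kth_element A ` {1..card A} = (!) (sorted_list_of_set A) ` (\<lambda>j. j - 1) ` {1..card A}"
    by (auto simp: kth_element_def)
  also have "(\<lambda>j. j - 1) ` {1..card A} = {..<card A}"
    by (auto simp: image_iff intro!: bexI[of _ "Suc _"])
  also have "(!) (sorted_list_of_set A) ` {..<card A} = set (sorted_list_of_set A)"
    by (auto simp: set_conv_nth)
  finally show ?thesis using assms by simp
qed

theorem theorem2:
  fixes n k :: nat and s :: "nat \<Rightarrow> int"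
  assumes "n > 0" and "k \<ge> 2"
    and "\<And>i. i \<in> {1..k - 1} \<Longrightarrow> s i \<ge> 2"
    and "s k \<in> {1, 2}"
    and "int n \<ge> (\<Sum>i = 1..k - 1. s i) + 2"
  shows "geometric_realization (neighborhood_complex (stable_kneser_graph n k s))
           homotopy_equivalent_space nsphere (nat (int n - (\<Sum>i = 1..k - 1. s i) - 2))"
proof -
  \<comment> \<open>The leftmost positions: start at 1 and take every gap as small as
    allowed.\<close>
  define p where "p l = 1 + (\<Sum>j\<in>{1..<l}. nat (s j))" for l
  define R where "R = n - p k"
  define S where "S = {A. stable n k s A}"
  have p1: "p 1 = 1" by (simp add: p_def)
  have p_Suc: "int (p (Suc l)) = int (p l) + s l" "p (Suc l) = p l + nat (s l)" if "l \<in> {1..<k}" for l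
  proof -
    have "2 \<le> s l" using that assms(3)[of l] by auto
    then show "int (p (Suc l)) = int (p l) + s l" "p (Suc l) = p l + nat (s l)"
      using that by (simp_all add: p_def)
  qed
  have gaps: "p i + 2 \<le> p (Suc i)" if "i \<in> {1..<k}" for i
  proof -
    have "2 \<le> s i" using that assms(3)[of i] by auto
    then show ?thesis using p_Suc(2)[OF that] by simp
  qed
  have "int (p k) = 1 + (\<Sum>i\<in>{1..<k}. s i)"
  proof -
    have "2 \<le> s i" if "i \<in> {1..<k}" for i using that assms(3)[of i] by auto
    then have "0 \<le> s i" if "i \<in> {1..<k}" for i using that by (meson order_trans zero_le_numeral)
    then show ?thesis by (simp add: p_def)
  qed
  moreover have "{1..<k} = {1..k - 1}" using assms(2) by auto
  ultimately have pk: "int (p k) = 1 + (\<Sum>i = 1..k - 1. s i)" by simp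
  \<comment> \<open>The successor in \<open>dim\<close> is the shift between the dimension in
    \<open>nsphere\<close> and the number of coordinates in \<open>unit_sphere\<close>.\<close>
  then have R: "1 \<le> R" "p k + R = n" and dim: "Suc (nat (int n - (\<Sum>i = 1..k - 1. s i) - 2)) = R"
    using assms(5) by (auto simp: R_def)
  have p_mono: "strict_mono_on {1..k} p"
    using strict_mono_on_positions[of k p, OF gaps] by simp

  \<comment> \<open>The second bound limits the spread: it is at most
    \<open>(p k + b) - (1 + a)\<close>, hence at most \<open>n - 2\<close>, which suffices since
    \<open>s k \<le> 2\<close>. The pairs \<open>(a, b)\<close> used below are \<open>(1, R)\<close>
    and \<open>(0, R - 1)\<close>.\<close>
  have chain_stable: "A \<in> S"
    if A: "A \<in> slack_chains p k 1 a b" and b: "p k + b \<le> n" "p k + b \<le> n - 1 + a" for A a b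
  proof -
    obtain f where f: "A = (\<lambda>l. p l + f l) ` {1..k}" "mono_on {1..k} f" "\<forall>l\<in>{1..k}. a \<le> f l \<and> f l \<le> b"
      using A by (auto simp: slack_chains_def)
    have sm: "strict_mono_on {1..k} (\<lambda>l. p l + f l)"
      using strict_mono_onD[OF p_mono] monotone_onD[OF f(2)]
      by (intro strict_mono_onI add_less_le_mono) auto
    have kth: "kth_element A l = p l + f l" if "l \<in> {1..k}" for l
      unfolding f(1) by (rule kth_element_image[OF sm that])
    have "card A = k"
      unfolding f(1) using strict_mono_on_imp_inj_on[OF sm] by (simp add: card_image)
    moreover have "A \<subseteq> {1..n}"
    proof -
      have "p l \<le> p k" "1 \<le> p l" if "l \<in> {1..k}" for l
        using that strict_mono_onD[OF p_mono, of l k] by (cases "l = k"; auto simp: p_def)+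
      then show ?thesis using f(3) b(1) by (fastforce simp: f(1))
    qed
    moreover have "s j \<le> int (kth_element A (j + 1)) - int (kth_element A j)" if "j \<in> {1..k - 1}" for j
    proof -
      have "f j \<le> f (Suc j)" using that monotone_onD[OF f(2), of j "Suc j"] by auto
      then show ?thesis using that p_Suc(1)[of j] by (auto simp: kth)
    qed
    moreover have "int (kth_element A k) - int (kth_element A 1) \<le> int n - s k"
    proof -
      have "kth_element A k \<le> p k + b" "1 + a \<le> kth_element A 1"
        using f(3) assms(2) by (auto simp: kth p1[unfolded One_nat_def])
      then show ?thesis using b assms(1,4) by auto
    qed
    ultimately show ?thesis by (simp add: S_def stable_def)
  qed

  \<comment> \<open>Missing 1 makes the first slack positive, the gap conditions make the slack
    weakly increasing, and the last element is at most \<open>n = p k + R\<close>.\<close>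
  have stable_chain: "A \<in> slack_chains p k 1 1 R" if A: "A \<in> S" "1 \<notin> A" for A
  proof -
    have st: "A \<subseteq> {1..n}" "card A = k"
      "\<And>j. j \<in> {1..k - 1} \<Longrightarrow> s j \<le> int (kth_element A (j + 1)) - int (kth_element A j)"
      using A(1) by (auto simp: S_def stable_def)
    have "finite A" using st(1) finite_subset by blast
    then have im: "A = kth_element A ` {1..k}"
      using image_kth_element[of A] st(2) by simp
    have gap: "int (p (Suc l)) - int (p l) \<le> int (kth_element A (Suc l)) - int (kth_element A l)"
      if "l \<in> {1..<k}" for l
    proof -
      have "l \<in> {1..k - 1}" using that by auto
      then show ?thesis using st(3)[of l] p_Suc(1)[OF that] by simp
    qed
    have low: "p l < kth_element A l" if "1 \<le> l" "l \<le> k" for l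
      using that
    proof (induction l rule: dec_induct)
      case base
      have "kth_element A 1 \<in> A" using im assms(2) by auto
      then have "kth_element A 1 \<noteq> 1" "1 \<le> kth_element A 1" using A(2) st(1) by auto
      then show ?case unfolding p1 by linarith
    next
      case (step l)
      then show ?case using gap[of l] by auto
    qed
    define f where "f l = kth_element A l - p l" for l
    have f_step: "f l \<le> f (Suc l)" if "l \<in> {1..<k}" for l
      using that gap[of l] low[of l] low[of "Suc l"] by (auto simp: f_def)
    have f_mono: "f l \<le> f m" if "1 \<le> l" "l \<le> m" "m \<le> k" for l m
      using that(2,3)
    proof (induction m rule: dec_induct)
      case (step m)
      then show ?case using f_step[of m] that(1) by auto
    qed simp
    have "kth_element A k \<in> A" using im assms(2) by auto
    then have "kth_element A k \<le> n" using st(1) by auto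
    then have "f k \<le> R" by (simp add: f_def R_def diff_le_mono)
    then have "f l \<le> R" if "l \<in> {1..k}" for l
      using f_mono[of l k] that by auto
    moreover have "1 \<le> f l" if "l \<in> {1..k}" for l
      using low[of l] that by (auto simp: f_def)
    moreover have "A = (\<lambda>l. p l + f l) ` {1..k}"
      by (subst im, rule image_cong) (use low in \<open>auto simp: f_def less_imp_le\<close>)
    ultimately show ?thesis
      unfolding slack_chains_def using f_mono by (auto intro!: exI[of _ f] monotone_onI)
  qed

  have "S \<subseteq> Pow {1..n}" by (auto simp: S_def stable_def)
  then have S: "finite S" "\<And>A. A \<in> S \<Longrightarrow> finite A"
    using finite_subset by blast+
  have "sign_space S S homotopy_eqv unit_sphere R"
  proof (rule sign_space_sphere[of k p, OF gaps _ R(1) S])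
    show "avoiding (p 1) S = slack_chains p k 1 1 R"
    proof (intro equalityI subsetI)
      show "A \<in> slack_chains p k 1 1 R" if "A \<in> avoiding (p 1) S" for A
        using that stable_chain[of A] unfolding avoiding_def p1 by blast
      show "A \<in> avoiding (p 1) S" if A: "A \<in> slack_chains p k 1 1 R" for A
        using chain_stable[OF A] slack_chains_inactive[OF p_mono _ A, of "p 1"] R by (simp add: avoiding_def)
    qed
    show "refines (slack_chains p k 2 0 (R - 1)) (removing (p 1) S)"
      unfolding refines_def
    proof
      fix Q assume "Q \<in> slack_chains p k 2 0 (R - 1)"
      then have "insert (p 1) Q \<in> slack_chains p k 1 0 (R - 1)"
        using slack_chains_extend[of Q p k 1 0 "R - 1"] assms(2) by (simp add: numeral_2_eq_2)
      then have "insert (p 1) Q \<in> S"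
        using R by (intro chain_stable) auto
      then show "\<exists>B\<in>removing (p 1) S. B \<subseteq> Q"
        by (intro bexI[of _ "insert (p 1) Q - {p 1}"]) (auto simp: removing_def)
    qed
  qed (use assms(2) in auto)
  moreover have "neighborhood_complex (stable_kneser_graph n k s) = {T. T \<subseteq> S \<and> (\<exists>B\<in>S. \<forall>A\<in>T. A \<inter> B = {})}"
    by (auto simp: neighborhood_complex_def stable_kneser_graph_def S_def)
  ultimately show ?thesis
    using realization_homotopy_eqv_sign_space[OF S] homotopy_eqv_trans
    unfolding nsphere_eq_unit_sphere dim geometric_realization_def euclidean_product_topology by simp
qed

end
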